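(* Let $P$ be a polyhedron in $\mathbb{R}^n$, for some integer $n\geq 1$, and let $(\nabla(P),\mathbb{1})$ be the finitely presented unital vector lattice of real-valued (continuous) piecewise linear functions on $P$. Then there is a unique vl-valuation $$\alpha\colon \nabla(P)\to\mathbb{R}$$ that assigns the value $1$ to each vl-Schauder hat in $\nabla(P)$. Moreover, the number $\alpha(\mathbb{1})$ is the Euler-Poincaré characteristic $\chi(P)$ of the polyhedron $P$.
   Context: Simplices are (closed) convex hulls of finitely many affinely independent points (the vertices) of a Euclidean space. A simplicial complex is a finite set of simplices closed under taking faces and such that any two of its simplices intersect either in the empty set or in a common face. The polyhedron $|K|$ of a simplicial complex $K$ is the union of its simplices. A polyhedron in $\mathbb{R}^n$ is a subset $P\subseteq\mathbb{R}^n$ with $P=|K|$ for some simplicial complex $K$; any such $K$ is a triangulation of $P$. Euler-Poincaré characteristic: $\chi(P)=\sum_{m=0}^n(-1)^m\alpha_m$, where $\alpha_m$ is the number of $m$-dimensional simplices of any triangulation of $P$ (the value does not depend on the triangulation). A function $f\colon P\to\mathbb{R}$ is piecewise linear if there are finitely many affine linear functions $f_1,\dots,f_m\colon\mathbb{R}^n\to\mathbb{R}$ such that for every $s\in P$ there is $i\leq m$ with $f(s)=f_i(s)$. $\nabla(P)$ is the set of all continuous piecewise linear functions $P\to\mathbb{R}$; it is a real vector lattice (Riesz space) under pointwise addition, real scalar multiplication, supremum $\vee$ and infimum $\wedge$. $\mathbb{1}\in\nabla(P)$ is the function identically equal to $1$, which is a strong order unit. For a vector lattice $V$, $V^+=\{v\in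 V: v\geq 0\}$. A vl-valuation on $V$ is a function $\nu\colon V\to\mathbb{R}$ such that: (V1) $\nu(0)=0$; (V2) for all $x,y\in V$, $\nu(x)+\nu(y)=\nu(x\vee y)+\nu(x\wedge y)$; (V3) for all $x,y\in V^+$, $\nu(x+y)=\nu(x\vee y)$; (V4) for all $x,y\in V^+$, if $x\wedge y=0$ then $\nu(x-y)=\nu(x)-\nu(y)$. A triangulation $K$ of $P$ linearizes $f\in\nabla(P)$ if $f$ is (affine) linear on each simplex of $K$. A vl-Schauder hat is an element $h\in\nabla(P)$ for which there are a triangulation $K_h$ of $P$ linearizing $h$ and a vertex $\bar x$ of $K_h$ such that $h(\bar x)=1$ and $h(x)=0$ for every other vertex $x$ of $K_h$. *)

theory Defs
  imports "HOL-Analysis.Analysis" "HOL-Library.Function_Algebras"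
begin

section \<open>Polyhedra and their triangulations\<close>

text \<open>
  The library constant \<^const>\<open>polyhedron\<close> means a finite intersection of half-spaces, and
  \<^const>\<open>triangulation\<close> does not require closure under faces; neither is used here.
  A nonempty \<^const>\<open>simplicial_complex\<close> also contains the empty set, as a simplex of
  dimension -1; this affects neither its union, nor its vertices, nor its simplices of
  dimension at least 0.
\<close>

definition triangulates :: "'a::euclidean_space set set \<Rightarrow> 'a set \<Rightarrow> bool"
  where "triangulates K P \<longleftrightarrow> simplicial_complex K \<and> \<Union>K = P"

definition compact_polyhedron :: "'a::euclidean_space set \<Rightarrow> bool"
  where "compact_polyhedron P \<longleftrightarrow> (\<exists>K. triangulates K P)"

definition vertex_of :: "'a::euclidean_space \<Rightarrow> 'a set set \<Rightarrow> bool"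
  where "vertex_of x K \<longleftrightarrow> (\<exists>C. \<not> affine_dependent C \<and> convex hull C \<in> K \<and> x \<in> C)"

definition complex_euler_char :: "'a::euclidean_space set set \<Rightarrow> int"
  where "complex_euler_char K =
    (\<Sum>m = 0..DIM('a). (- 1) ^ m * int (card {S \<in> K. int m simplex S}))"

definition euler_char :: "'a::euclidean_space set \<Rightarrow> int"
  where "euler_char P = complex_euler_char (SOME K. triangulates K P)"

section \<open>The vector lattice of continuous piecewise linear functions\<close>

definition affine_fun :: "('a::euclidean_space \<Rightarrow> real) \<Rightarrow> bool"
  where "affine_fun f \<longleftrightarrow> (\<exists>g c. linear g \<and> f = (\<lambda>x. g x + c))"

definition piecewise_linear_on :: "'a::euclidean_space set \<Rightarrow> ('a \<Rightarrow> real) \<Rightarrow> bool"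
  where "piecewise_linear_on P f \<longleftrightarrow>
    (\<exists>F. finite F \<and> (\<forall>g\<in>F. affine_fun g) \<and> (\<forall>s\<in>P. \<exists>g\<in>F. f s = g s))"

text \<open>
  A function on P is represented by its extension by 0 outside P, so that distinct elements of
  \<open>nabla P\<close> are distinct functions on P and the vector lattice operations and the order are the
  pointwise ones of the function type. The unit is then \<open>indicator P\<close>, not the constant 1.
\<close>

definition nabla :: "'a::euclidean_space set \<Rightarrow> ('a \<Rightarrow> real) set"
  where "nabla P =
    {f. continuous_on P f \<and> piecewise_linear_on P f \<and> (\<forall>x. x \<notin> P \<longrightarrow> f x = 0)}"

definition linearizes :: "'a::euclidean_space set set \<Rightarrow> ('a \<Rightarrow> real) \<Rightarrow> bool"
  where "linearizes K f \<longleftrightarrow> (\<forall>S\<in>K. \<exists>g. affine_fun g \<and> (\<forall>x\<in>S. f x = g x))"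

definition vl_schauder_hat :: "'a::euclidean_space set \<Rightarrow> ('a \<Rightarrow> real) \<Rightarrow> bool"
  where "vl_schauder_hat P h \<longleftrightarrow> h \<in> nabla P \<and>
    (\<exists>K x. triangulates K P \<and> linearizes K h \<and> vertex_of x K \<and>
      h x = 1 \<and> (\<forall>y. vertex_of y K \<and> y \<noteq> x \<longrightarrow> h y = 0))"

text \<open>
  \<open>V\<close> is the carrier of a vector lattice whose operations are those of the type; only the values
  of \<open>\<nu>\<close> on \<open>V\<close> are constrained.
\<close>

definition vl_valuation :: "'v::{ab_group_add, lattice} set \<Rightarrow> ('v \<Rightarrow> real) \<Rightarrow> bool"
  where "vl_valuation V \<nu> \<longleftrightarrow>
    \<nu> 0 = 0 \<and>
    (\<forall>x\<in>V. \<forall>y\<in>V. \<nu> x + \<nu> y = \<nu> (sup x y) + \<nu> (inf x y)) \<and>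
    (\<forall>x\<in>V. \<forall>y\<in>V. 0 \<le> x \<and> 0 \<le> y \<longrightarrow> \<nu> (x + y) = \<nu> (sup x y)) \<and>
    (\<forall>x\<in>V. \<forall>y\<in>V. 0 \<le> x \<and> 0 \<le> y \<and> inf x y = 0 \<longrightarrow> \<nu> (x - y) = \<nu> x - \<nu> y)"

section \<open>Closure of \<open>nabla P\<close> under the vector lattice operations\<close>

lemma affine_fun_const: "affine_fun (\<lambda>x. c)"
  unfolding affine_fun_def by (rule exI[of _ "\<lambda>x. 0"]) (auto simp: linear_zero)

lemma affine_fun_add: "affine_fun f \<Longrightarrow> affine_fun g \<Longrightarrow> affine_fun (\<lambda>x. f x + g x)"
proof -
  assume "affine_fun f" "affine_fun g"
  then obtain a b c d where "linear a" "linear c" "f = (\<lambda>x. a x + b)" "g = (\<lambda>x. c x + d)"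
    unfolding affine_fun_def by blast
  then show ?thesis unfolding affine_fun_def
    by (intro exI[of _ "\<lambda>x. a x + c x"] exI[of _ "b + d"]) (auto simp: linear_compose_add)
qed

lemma affine_fun_scale: "affine_fun f \<Longrightarrow> affine_fun (\<lambda>x. k * f x)"
proof -
  assume "affine_fun f"
  then obtain a b where "linear a" "f = (\<lambda>x. a x + b)"
    unfolding affine_fun_def by blast
  have "linear (\<lambda>x. k * a x)"
    using linear_compose_scale_right[OF \<open>linear a\<close>, of k] by simp
  moreover have "(\<lambda>x. k * f x) = (\<lambda>x. k * a x + k * b)"
    using \<open>f = (\<lambda>x. a x + b)\<close> by (simp add: distrib_left)
  ultimately show ?thesis unfolding affine_fun_def by blast
qed

lemma piecewise_linear_onI:
  assumes "finite F" "\<forall>u\<in>F. affine_fun u" "\<And>s. s \<in> P \<Longrightarrow> \<exists>u\<in>F. f s = u s"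
  shows "piecewise_linear_on P f"
  unfolding piecewise_linear_on_def using assms by (intro exI[of _ F] conjI ballI) simp_all

lemma piecewise_linear_on_add:
  assumes "piecewise_linear_on P f" "piecewise_linear_on P g"
  shows "piecewise_linear_on P (\<lambda>x. f x + g x)"
proof -
  obtain F where F: "finite F" "\<forall>u\<in>F. affine_fun u" "\<forall>s\<in>P. \<exists>u\<in>F. f s = u s"
    using assms(1) unfolding piecewise_linear_on_def by (elim exE conjE)
  obtain G where G: "finite G" "\<forall>u\<in>G. affine_fun u" "\<forall>s\<in>P. \<exists>u\<in>G. g s = u s"
    using assms(2) unfolding piecewise_linear_on_def by (elim exE conjE)
  let ?H = "(\<lambda>(u, v). (\<lambda>x. u x + v x)) ` (F \<times> G)"
  have "finite ?H" "\<forall>w\<in>?H. affine_fun w"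
    using F(1,2) G(1,2) by (auto intro: affine_fun_add)
  moreover have "\<exists>w\<in>?H. f s + g s = w s" if "s \<in> P" for s
  proof -
    obtain u v where "u \<in> F" "v \<in> G" "f s = u s" "g s = v s" using F(3) G(3) \<open>s \<in> P\<close> by meson
    then show ?thesis by (intro bexI[of _ "\<lambda>x. u x + v x"] image_eqI[of _ _ "(u, v)"]) simp_all
  qed
  ultimately show ?thesis by (rule piecewise_linear_onI)
qed

lemma piecewise_linear_on_scale:
  assumes "piecewise_linear_on P f"
  shows "piecewise_linear_on P (\<lambda>x. k * f x)"
proof -
  obtain F where F: "finite F" "\<forall>u\<in>F. affine_fun u" "\<forall>s\<in>P. \<exists>u\<in>F. f s = u s"
    using assms unfolding piecewise_linear_on_def by (elim exE conjE)
  let ?H = "(\<lambda>u x. k * u x) ` F"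
  have "finite ?H" "\<forall>w\<in>?H. affine_fun w"
    using F(1,2) by (auto intro: affine_fun_scale)
  moreover have "\<exists>w\<in>?H. k * f s = w s" if "s \<in> P" for s
  proof -
    obtain u where "u \<in> F" "f s = u s" using F(3) \<open>s \<in> P\<close> by blast
    then show ?thesis by (intro bexI[of _ "\<lambda>x. k * u x"] imageI) simp_all
  qed
  ultimately show ?thesis by (rule piecewise_linear_onI)
qed

lemma piecewise_linear_on_choice:
  assumes "piecewise_linear_on P f" "piecewise_linear_on P g"
    and "\<And>x. x \<in> P \<Longrightarrow> h x = f x \<or> h x = g x"
  shows "piecewise_linear_on P h"
proof -
  obtain F where F: "finite F" "\<forall>u\<in>F. affine_fun u" "\<forall>s\<in>P. \<exists>u\<in>F. f s = u s"
    using assms(1) unfolding piecewise_linear_on_def by (elim exE conjE)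
  obtain G where G: "finite G" "\<forall>u\<in>G. affine_fun u" "\<forall>s\<in>P. \<exists>u\<in>G. g s = u s"
    using assms(2) unfolding piecewise_linear_on_def by (elim exE conjE)
  have "finite (F \<union> G)" "\<forall>u\<in>F \<union> G. affine_fun u"
    using F(1,2) G(1,2) by blast+
  moreover have "\<exists>u\<in>F \<union> G. h s = u s" if "s \<in> P" for s
  proof -
    obtain u v where uv: "u \<in> F" "v \<in> G" "f s = u s" "g s = v s"
      using F(3) G(3) \<open>s \<in> P\<close> by meson
    from assms(3)[OF \<open>s \<in> P\<close>] show ?thesis
    proof
      assume "h s = f s"
      with uv show ?thesis by (intro bexI[of _ u]) simp_all
    next
      assume "h s = g s"
      with uv show ?thesis by (intro bexI[of _ v]) simp_all
    qed
  qed
  ultimately show ?thesis by (rule piecewise_linear_onI)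
qed

lemma piecewise_linear_on_const: "(\<And>x. x \<in> P \<Longrightarrow> f x = c) \<Longrightarrow> piecewise_linear_on P f"
  unfolding piecewise_linear_on_def
  by (rule exI[of _ "{\<lambda>x. c}"]) (simp add: affine_fun_const)

lemma nabla_zero: "0 \<in> nabla P"
  by (simp add: nabla_def zero_fun_def piecewise_linear_on_const[of _ _ 0])

lemma nabla_unit: "indicator P \<in> nabla P"
proof -
  have "continuous_on P (indicator P :: 'a \<Rightarrow> real)"
    by (rule continuous_on_eq[of P "\<lambda>x. 1"]) simp_all
  moreover have "piecewise_linear_on P (indicator P :: 'a \<Rightarrow> real)"
    by (rule piecewise_linear_on_const[of _ _ 1]) simp
  ultimately show ?thesis by (simp add: nabla_def)
qed

lemma nabla_add: "f \<in> nabla P \<Longrightarrow> g \<in> nabla P \<Longrightarrow> f + g \<in> nabla P"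
  unfolding nabla_def plus_fun_def
  by (auto intro: continuous_on_add piecewise_linear_on_add)

lemma nabla_scale: "f \<in> nabla P \<Longrightarrow> (\<lambda>x. k * f x) \<in> nabla P"
  unfolding nabla_def
  by (auto intro: continuous_on_mult_left piecewise_linear_on_scale)

lemma nabla_diff:
  assumes "f \<in> nabla P" "g \<in> nabla P"
  shows "f - g \<in> nabla P"
proof -
  have "f - g = f + (\<lambda>x. (- 1) * g x)"
    by (rule ext) simp
  then show ?thesis
    by (simp only: nabla_add[OF assms(1) nabla_scale[OF assms(2), of "- 1"]])
qed

lemma nabla_sup:
  assumes f: "f \<in> nabla P" and g: "g \<in> nabla P"
  shows "sup f g \<in> nabla P"
proof -
  have eq: "sup f g = (\<lambda>x. max (f x) (g x))"
    by (rule ext) (simp only: sup_fun_def sup_real_def)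
  have "continuous_on P (\<lambda>x. max (f x) (g x))"
    using f g unfolding nabla_def by (intro continuous_on_max) simp_all
  moreover have "piecewise_linear_on P (\<lambda>x. max (f x) (g x))"
  proof (rule piecewise_linear_on_choice)
    show "piecewise_linear_on P f" "piecewise_linear_on P g"
      using f g unfolding nabla_def by simp_all
    show "max (f x) (g x) = f x \<or> max (f x) (g x) = g x" for x
      by linarith
  qed
  ultimately show ?thesis
    using f g unfolding eq nabla_def by simp
qed

lemma nabla_inf:
  assumes f: "f \<in> nabla P" and g: "g \<in> nabla P"
  shows "inf f g \<in> nabla P"
proof -
  have eq: "inf f g = (\<lambda>x. min (f x) (g x))"
    by (rule ext) (simp only: inf_fun_def inf_real_def)
  have "continuous_on P (\<lambda>x. min (f x) (g x))"
    using f g unfolding nabla_def by (intro continuous_on_min) simp_all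
  moreover have "piecewise_linear_on P (\<lambda>x. min (f x) (g x))"
  proof (rule piecewise_linear_on_choice)
    show "piecewise_linear_on P f" "piecewise_linear_on P g"
      using f g unfolding nabla_def by simp_all
    show "min (f x) (g x) = f x \<or> min (f x) (g x) = g x" for x
      by linarith
  qed
  ultimately show ?thesis
    using f g unfolding eq nabla_def by simp
qed

end

theory Submission
  imports Defs
begin

text \<open>
  Existence: if \<open>K\<close> linearizes \<open>f\<close>, put \<open>\<alpha> f = e K f - e K (- f)\<close>, where \<open>e K f\<close> is the alternating
  sum over the nonempty simplices of \<open>K\<close> on which \<open>f > 0\<close>. It does not depend on \<open>K\<close>: for small
  \<open>t > 0\<close>, the indicator of \<open>{f \<ge> t}\<close> is a combination, with coefficients adding up to \<open>e K f\<close>, of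
  indicators of nonempty compact convex sets, and a combination of such indicators determines the
  sum of its coefficients (induction on the dimension, slicing by hyperplanes). The axioms are then
  read off a triangulation linearizing all functions involved.

  Uniqueness: a vl-valuation takes the same value on nonnegative functions that bound each other up
  to constants, so a nonnegative \<open>f\<close> linearized by \<open>K\<close> may be replaced by the supremum of the hats of
  those vertices of \<open>K\<close> where \<open>f > 0\<close>. By (V2) the value there is determined by the values on infima
  of hats of \<open>K\<close>. Such an infimum is 0 if its vertices do not span a simplex, and otherwise it is,
  up to a factor, a hat of the stellar subdivision at the barycenter of that simplex.
\<close>

section \<open>The Euler characteristic of combinations of convex sets\<close>

text \<open>The difference in the definition of \<open>\<alpha>\<close> is forced by (V4), applied
  to the positive and negative parts of \<open>f\<close>. The obstacle is independence of
  \<open>K\<close>. The set where \<open>f > 0\<close> is in general not compact, while the slicing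
  argument works with compact convex sets; hence the threshold \<open>t\<close>, chosen below all
  positive vertex values so that the combinatorics stays the same. The cut of a closed simplex by
  \<open>f \<ge> t\<close> is compact and convex, but closed simplices overlap. Moebius inversion
  over the faces \<open>F\<close> of each vertex set \<open>V\<close>, with sign (-1)^(|V| + |F|),
  replaces them by the disjoint relative interiors, at the price of a sum over pairs
  \<open>(V, F)\<close>. A cut is nonempty exactly when \<open>F\<close> has a vertex where
  \<open>f > 0\<close>, and the alternating sum over \<open>F\<close> then leaves only those
  \<open>V\<close> on which \<open>f\<close> is positive throughout. No homology enters, and the
  independence of the Euler characteristic from the triangulation comes out as the case of the
  unit.\<close>

text \<open>Comparing the vanishing sums at \<open>s\<close> and slightly to the right of
  \<open>s\<close> isolates the intervals that end at \<open>s\<close>, so their coefficients add up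
  to 0. Grouping \<open>I\<close> by right endpoints finishes the argument.\<close>

lemma sum_eq_0_if_interval_indicator_sum_eq_0:
  fixes a :: "'i \<Rightarrow> real" and p q :: "'i \<Rightarrow> real"
  assumes fin: "finite I" and pq: "\<And>i. i \<in> I \<Longrightarrow> p i \<le> q i"
    and zero: "\<And>t. sum a {i \<in> I. p i \<le> t \<and> t \<le> q i} = 0"
  shows "sum a I = 0"
proof -
  have "sum a {i \<in> I. q i = s} = 0" for s
  proof -
    \<comment> \<open>All endpoints beyond \<open>s\<close>; the extra \<open>s + 1\<close> only
      keeps the set nonempty, so that \<open>Min\<close> makes sense.\<close>
    define M where "M = insert (s + 1) {x \<in> p ` I \<union> q ` I. s < x}"
    have M: "finite M" "M \<noteq> {}" "\<And>x. x \<in> M \<Longrightarrow> s < x"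
      using fin by (auto simp: M_def)
    obtain t where t: "s < t" "t < Min M"
      using M by (metis Min_gr_iff dense)
    have t_less: "t < x" if "x \<in> p ` I \<union> q ` I" "s < x" for x
    proof -
      have "x \<in> M"
        using that by (simp add: M_def)
      then show ?thesis
        using t(2) Min_le[OF M(1)] by force
    qed
    \<comment> \<open>No endpoint lies in the half-open interval from \<open>s\<close> (excluded) to
      \<open>t\<close>.\<close>
    have "{i \<in> I. p i \<le> t \<and> t \<le> q i} = {i \<in> I. p i \<le> s \<and> s < q i}"
    proof (rule Collect_cong, rule conj_cong[OF refl])
      fix i assume "i \<in> I"
      then have "p i \<in> p ` I \<union> q ` I" "q i \<in> p ` I \<union> q ` I"
        by auto
      then show "(p i \<le> t \<and> t \<le> q i) = (p i \<le> s \<and> s < q i)"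
        using t(1) t_less[of "p i"] t_less[of "q i"] by linarith
    qed
    then have "sum a {i \<in> I. p i \<le> s \<and> s < q i} = 0"
      using zero[of t] by simp
    moreover have "{i \<in> I. p i \<le> s \<and> s \<le> q i} = {i \<in> I. p i \<le> s \<and> s < q i} \<union> {i \<in> I. q i = s}"
      using pq by force
    then have "sum a {i \<in> I. p i \<le> s \<and> s \<le> q i}
        = sum a {i \<in> I. p i \<le> s \<and> s < q i} + sum a {i \<in> I. q i = s}"
      using fin by (auto intro: sum.union_disjoint)
    ultimately show ?thesis
      using zero[of s] by simp
  qed
  then show ?thesis
    using sum.image_gen[OF fin, of a q] by simp
qed

text \<open>\<open>B\<close> holds the coordinate directions in which the sets may still vary; the
  other coordinates are frozen at \<open>c\<close>. Induction on \<open>B\<close> ends with all sets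
  equal to one point. In the inductive step each projection to the new direction is a compact
  interval, and the slices reduce the claim to the interval case.\<close>

lemma sum_eq_0_if_convex_indicator_sum_eq_0_flat:
  fixes C :: "'i \<Rightarrow> 'a::euclidean_space set" and a :: "'i \<Rightarrow> real"
  assumes "B \<subseteq> Basis" "finite I"
    and "\<And>i. i \<in> I \<Longrightarrow> compact (C i) \<and> convex (C i) \<and> C i \<noteq> {}"
    and "\<And>i x b. i \<in> I \<Longrightarrow> x \<in> C i \<Longrightarrow> b \<in> Basis - B \<Longrightarrow> x \<bullet> b = c b"
    and "\<And>z. sum a {i \<in> I. z \<in> C i} = 0"
  shows "sum a I = 0"
proof -
  have "finite B"
    using assms(1) finite_Basis finite_subset by blast
  then show ?thesis
    using assms
  proof (induction arbitrary: I C c rule: finite_induct)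
    case empty
    define z where "z = (\<Sum>b\<in>Basis. c b *\<^sub>R b)"
    have "x = z" if "i \<in> I" "x \<in> C i" for i x
      unfolding z_def using empty.prems(4)[OF that] by (simp add: euclidean_eq_iff[of x])
    then have "{i \<in> I. z \<in> C i} = I"
      using empty.prems(3) by fastforce
    then show ?case
      using empty.prems(5)[of z] by simp
  next
    case (insert b B)
    have "\<exists>p q. p \<le> q \<and> (\<lambda>x. x \<bullet> b) ` C i = {p..q}" if "i \<in> I" for i
    proof -
      have "connected (C i)"
        using insert.prems(3)[OF that] convex_connected by blast
      then have "compact ((\<lambda>x. x \<bullet> b) ` C i)" "connected ((\<lambda>x. x \<bullet> b) ` C i)"
        using insert.prems(3)[OF that]
        by (auto intro!: compact_continuous_image connected_continuous_image continuous_intros)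
      then obtain p q where "(\<lambda>x. x \<bullet> b) ` C i = {p..q}"
        using connected_compact_interval_1 by metis
      then show ?thesis
        using insert.prems(3)[OF that] by (metis atLeastatMost_empty_iff2 image_is_empty)
    qed
    then obtain p q where pq: "\<And>i. i \<in> I \<Longrightarrow> p i \<le> q i \<and> (\<lambda>x. x \<bullet> b) ` C i = {p i..q i}"
      by metis
    \<comment> \<open>The indices in this sum are those whose slice at height \<open>t\<close> is
      nonempty; the induction hypothesis is applied to these slices, with coordinate
      \<open>b\<close> frozen at \<open>t\<close>.\<close>
    have "sum a {i \<in> I. p i \<le> t \<and> t \<le> q i} = 0" for t
    proof -
      define J where "J = {i \<in> I. p i \<le> t \<and> t \<le> q i}"
      define D where "D i = C i \<inter> {x. b \<bullet> x = t}" for i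
      have "sum a J = 0"
      proof (rule insert.IH[where C = D and c = "c(b := t)"])
        show "B \<subseteq> Basis" "finite J"
          using insert.prems by (auto simp: J_def)
      next
        fix i assume i: "i \<in> J"
        have "D i \<noteq> {}"
        proof -
          have "t \<in> (\<lambda>x. x \<bullet> b) ` C i"
            using pq[of i] i by (auto simp: J_def)
          then show ?thesis
            by (auto simp: D_def inner_commute)
        qed
        then show "compact (D i) \<and> convex (D i) \<and> D i \<noteq> {}"
          using insert.prems(3)[of i] i
          by (auto simp: D_def J_def closed_hyperplane convex_hyperplane
              intro!: compact_Int_closed convex_Int)
      next
        fix i x b' assume "i \<in> J" "x \<in> D i" "b' \<in> Basis - B"
        then show "x \<bullet> b' = (c(b := t)) b'"
          using insert.prems(4)[of i x b'] by (auto simp: J_def D_def inner_commute[of x b])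
      next
        fix z
        show "sum a {i \<in> J. z \<in> D i} = 0"
        proof (cases "b \<bullet> z = t")
          case True
          have "i \<in> J" if "i \<in> I" "z \<in> C i" for i
          proof -
            have "z \<bullet> b \<in> {p i..q i}"
              using pq[OF that(1)] that(2) by blast
            then show ?thesis
              using True that by (auto simp: J_def inner_commute)
          qed
          then have "{i \<in> J. z \<in> D i} = {i \<in> I. z \<in> C i}"
            using True by (auto simp: D_def J_def)
          then show ?thesis
            using insert.prems(5) by simp
        next
          case False
          then have "{i \<in> J. z \<in> D i} = {}"
            by (auto simp: D_def)
          then show ?thesis
            by (simp only: sum.empty)
        qed
      qed
      then show ?thesis
        by (simp add: J_def)
    qed
    then show ?case
      using sum_eq_0_if_interval_indicator_sum_eq_0[of I p q a] insert.prems(2) pq by blast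
  qed
qed

lemma sum_eq_0_if_convex_indicator_sum_eq_0:
  fixes C :: "'i \<Rightarrow> 'a::euclidean_space set" and a :: "'i \<Rightarrow> real"
  assumes "finite I"
    and "\<And>i. i \<in> I \<Longrightarrow> compact (C i) \<and> convex (C i)"
    and "\<And>z. sum a {i \<in> I. z \<in> C i} = 0"
  shows "sum a {i \<in> I. C i \<noteq> {}} = 0"
proof (rule sum_eq_0_if_convex_indicator_sum_eq_0_flat[where B = Basis and C = C and c = "\<lambda>_. 0"])
  show "sum a {i \<in> {i \<in> I. C i \<noteq> {}}. z \<in> C i} = 0" for z
  proof -
    have "{i \<in> {i \<in> I. C i \<noteq> {}}. z \<in> C i} = {i \<in> I. z \<in> C i}"
      by auto
    then show ?thesis
      using assms(3) by simp
  qed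
qed (use assms in auto)

text \<open>If \<open>T \<noteq> V\<close>, adding or removing a fixed element of
  \<open>V - T\<close> pairs the sets between \<open>T\<close> and \<open>V\<close> with opposite
  signs.\<close>

lemma sum_minus_one_power_Icc:
  assumes "finite V" "T \<subseteq> V"
  shows "(\<Sum>B | T \<subseteq> B \<and> B \<subseteq> V. (- 1) ^ card B) = (if T = V then (- 1) ^ card V else (0::real))"
proof (cases "T = V")
  case True
  then have "{B. T \<subseteq> B \<and> B \<subseteq> V} = {V}"
    by auto
  then show ?thesis
    using True by simp
next
  case False
  then obtain v where v: "v \<in> V" "v \<notin> T"
    using assms by blast
  define A where "A = {B. T \<subseteq> B \<and> B \<subseteq> V \<and> v \<notin> B}"
  have fin: "finite A"
    using assms(1) by (auto simp: A_def intro: finite_subset[of _ "Pow V"])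
  have "B \<in> A \<union> insert v ` A" if "T \<subseteq> B" "B \<subseteq> V" for B
  proof (cases "v \<in> B")
    case True
    then have "B = insert v (B - {v})" "B - {v} \<in> A"
      using that v by (auto simp: A_def)
    then show ?thesis
      by blast
  qed (use that in \<open>auto simp: A_def\<close>)
  then have "{B. T \<subseteq> B \<and> B \<subseteq> V} = A \<union> insert v ` A"
    using v by (auto simp: A_def)
  moreover have "A \<inter> insert v ` A = {}" "inj_on (insert v) A"
    by (auto simp: A_def inj_on_def)
  moreover have "card (insert v B) = Suc (card B)" if "B \<in> A" for B
    using that finite_subset[OF _ assms(1), of B] by (simp add: A_def)
  ultimately show ?thesis
    using False fin by (simp add: sum.union_disjoint sum.reindex sum_negf)
qed

section \<open>Barycentric coordinates and hats\<close>

text \<open>Weights are total functions that vanish off \<open>T\<close>. Uniqueness is then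
  equality of functions, and weights with respect to different sets can be compared
  directly.\<close>

definition barycentric :: "'a::euclidean_space set \<Rightarrow> ('a \<Rightarrow> real) \<Rightarrow> 'a \<Rightarrow> bool"
  where "barycentric T u x \<longleftrightarrow>
    (\<forall>v\<in>T. 0 \<le> u v) \<and> (\<forall>v. v \<notin> T \<longrightarrow> u v = 0) \<and> sum u T = 1 \<and> (\<Sum>v\<in>T. u v *\<^sub>R v) = x"

lemma convex_hull_iff_barycentric:
  assumes "finite T"
  shows "x \<in> convex hull T \<longleftrightarrow> (\<exists>u. barycentric T u x)"
proof
  assume "x \<in> convex hull T"
  then obtain u where u: "\<forall>v\<in>T. 0 \<le> u v" "sum u T = 1" "(\<Sum>v\<in>T. u v *\<^sub>R v) = x"
    using assms by (auto simp: convex_hull_finite)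
  then have "barycentric T (\<lambda>v. if v \<in> T then u v else 0) x"
    by (simp add: barycentric_def cong: sum.cong)
  then show "\<exists>u. barycentric T u x"
    by blast
next
  assume "\<exists>u. barycentric T u x"
  then show "x \<in> convex hull T"
    using assms by (auto simp: convex_hull_finite barycentric_def)
qed

lemma barycentric_imp_convex_hull:
  "finite T \<Longrightarrow> barycentric T u x \<Longrightarrow> x \<in> convex hull T"
  unfolding convex_hull_iff_barycentric by (rule exI)

lemma barycentric_mono:
  assumes "barycentric S u x" "S \<subseteq> T" "finite T"
  shows "barycentric T u x"
proof -
  have zero: "u v = 0" if "v \<notin> S" for v
    using assms that by (auto simp: barycentric_def)
  from zero have "sum u T = sum u S" "(\<Sum>v\<in>T. u v *\<^sub>R v) = (\<Sum>v\<in>S. u v *\<^sub>R v)"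
    using assms by (auto intro!: sum.mono_neutral_right)
  moreover have "0 \<le> u v" for v
    using assms(1) by (cases "v \<in> S") (auto simp: barycentric_def)
  ultimately show ?thesis
    using assms zero by (auto simp: barycentric_def)
qed

lemma barycentric_restrict:
  assumes "barycentric T u x" "S \<subseteq> T" "finite T" "{v. u v \<noteq> 0} \<subseteq> S"
  shows "barycentric S u x"
proof -
  have zero: "u v = 0" if "v \<notin> S" for v
    using assms that by (auto simp: barycentric_def)
  from zero have "sum u T = sum u S" "(\<Sum>v\<in>T. u v *\<^sub>R v) = (\<Sum>v\<in>S. u v *\<^sub>R v)"
    using assms by (auto intro!: sum.mono_neutral_right)
  moreover have "0 \<le> u v" for v
    using assms(1) by (cases "v \<in> T") (auto simp: barycentric_def)
  ultimately show ?thesis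
    using assms zero by (auto simp: barycentric_def)
qed

lemma barycentric_unique:
  assumes "\<not> affine_dependent T" "barycentric T u x" "barycentric T u' x"
  shows "u = u'"
proof
  fix v
  have fin: "finite T"
    using assms(1) aff_independent_finite by blast
  have "(\<Sum>v\<in>T. u v - u' v) = 0" "(\<Sum>v\<in>T. (u v - u' v) *\<^sub>R v) = 0"
    using assms(2,3) by (simp_all add: barycentric_def sum_subtractf scaleR_diff_left)
  then have "\<forall>v\<in>T. u v - u' v = 0"
    using assms(1) affine_dependent_explicit_finite[OF fin] by metis
  then show "u v = u' v"
    using assms(2,3) by (cases "v \<in> T") (auto simp: barycentric_def)
qed

lemma barycentric_vertex:
  assumes "finite T" "v \<in> T"
  shows "barycentric T (\<lambda>w. if w = v then 1 else 0) v"
proof -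
  have "(\<Sum>w\<in>T. (if w = v then 1 else 0) *\<^sub>R w) = (\<Sum>w\<in>T. if w = v then w else 0)"
    by (rule sum.cong) auto
  then show ?thesis
    using assms by (auto simp: barycentric_def)
qed

lemma affine_fun_barycentric:
  assumes "affine_fun g" "barycentric T u x"
  shows "g x = (\<Sum>v\<in>T. u v * g v)"
proof -
  obtain l c where l: "linear l" "g = (\<lambda>x. l x + c)"
    using assms(1) by (auto simp: affine_fun_def)
  have "l x = (\<Sum>v\<in>T. u v * l v)"
    using assms(2) linear_sum[OF l(1), of "\<lambda>v. u v *\<^sub>R v" T] linear_cmul[OF l(1)]
    by (simp add: barycentric_def)
  moreover have "(\<Sum>v\<in>T. u v * c) = c"
    using assms(2) by (simp add: barycentric_def flip: sum_distrib_right)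
  ultimately show ?thesis
    by (simp add: l(2) distrib_left sum.distrib)
qed

lemma affine_interpolation:
  fixes p :: "'a::euclidean_space \<Rightarrow> real"
  assumes "\<not> affine_dependent T"
  obtains g where "affine_fun g" "\<And>v. v \<in> T \<Longrightarrow> g v = p v"
proof (cases "T = {}")
  case True
  then show ?thesis
    using that affine_fun_const by blast
next
  case False
  then obtain a where a: "a \<in> T"
    by blast
  have "independent ((\<lambda>x. - a + x) ` (T - {a}))"
    using assms affine_dependent_iff_dependent2[OF a] by blast
  from linear_independent_extend[OF this, of "\<lambda>y. p (a + y) - p a"]
  obtain l :: "'a \<Rightarrow> real" where l: "linear l"
      "\<forall>y\<in>(\<lambda>x. - a + x) ` (T - {a}). l y = p (a + y) - p a"
    by blast
  have "affine_fun (\<lambda>x. l x + (p a - l a))"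
    using l(1) by (auto simp: affine_fun_def)
  moreover have "l v + (p a - l a) = p v" if "v \<in> T" for v
  proof (cases "v = a")
    case False
    then have "l (- a + v) = p v - p a"
      using l(2) that by auto
    then show ?thesis
      using linear_diff[OF l(1), of v a] by simp
  qed simp
  ultimately show ?thesis
    using that by blast
qed

lemma affine_fun_continuous_on:
  assumes "affine_fun g"
  shows "continuous_on S g"
proof -
  obtain l c where "linear l" "g = (\<lambda>x. l x + c)"
    using assms by (auto simp: affine_fun_def)
  then show ?thesis
    by (simp add: continuous_on_add linear_continuous_on linear_conv_bounded_linear)
qed

section \<open>Vertex sets and global barycentric coordinates of a complex\<close>

text \<open>The abstract complex underlying \<open>K\<close>. It contains the empty set when
  \<open>K\<close> is nonempty, hence the conditions \<open>T \<noteq> {}\<close> in later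
  sums.\<close>

definition vertex_sets :: "'a::euclidean_space set set \<Rightarrow> 'a set set"
  where "vertex_sets K = {T. \<not> affine_dependent T \<and> convex hull T \<in> K}"

lemma vertex_of_iff: "vertex_of x K \<longleftrightarrow> x \<in> \<Union>(vertex_sets K)"
  by (auto simp: vertex_of_def vertex_sets_def)

lemma vertex_sets_finite: "T \<in> vertex_sets K \<Longrightarrow> finite T"
  by (auto simp: vertex_sets_def aff_independent_finite)

lemma convex_hull_affine_independent_inject:
  fixes S T :: "'a::euclidean_space set"
  assumes "\<not> affine_dependent S" "\<not> affine_dependent T" "convex hull S = convex hull T"
  shows "S = T"
  using extreme_point_of_convex_hull_affine_independent[OF assms(1)]
    extreme_point_of_convex_hull_affine_independent[OF assms(2)] assms(3) by (metis subsetI subset_antisym)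

lemma inj_on_convex_hull_vertex_sets: "inj_on ((hull) convex) (vertex_sets K)"
  by (rule inj_onI) (simp add: vertex_sets_def convex_hull_affine_independent_inject)

text \<open>For a vertex \<open>v\<close> this is its hat in \<open>K\<close>. The value 0 off the
  polyhedron matches the convention of \<open>nabla\<close>. That the description is unique is the
  content of \<open>bary_eqI\<close>.\<close>

definition bary :: "'a::euclidean_space set set \<Rightarrow> 'a \<Rightarrow> 'a \<Rightarrow> real"
  where "bary K v x =
    (if x \<in> \<Union>K then (THE u. \<exists>T\<in>vertex_sets K. barycentric T u x) v else 0)"

context
  fixes K :: "'a::euclidean_space set set"
  assumes K: "simplicial_complex K"
begin

lemma convex_hull_vertex_sets: "((hull) convex) ` vertex_sets K = K"
  using K by (auto simp: simplicial_complex_def simplex_def vertex_sets_def image_iff)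

lemma Union_complex: "\<Union>K = (\<Union>T\<in>vertex_sets K. convex hull T)"
  by (simp add: convex_hull_vertex_sets)

lemma finite_vertex_sets: "finite (vertex_sets K)"
  using K by (intro finite_imageD[OF _ inj_on_convex_hull_vertex_sets])
    (simp add: convex_hull_vertex_sets simplicial_complex_def)

lemma finite_vertices: "finite (\<Union>(vertex_sets K))"
  using finite_vertex_sets vertex_sets_finite by blast

lemma vertex_sets_subset:
  assumes "T \<in> vertex_sets K" "S \<subseteq> T"
  shows "S \<in> vertex_sets K"
proof -
  have "convex hull S face_of convex hull T"
    using assms face_of_convex_hull_affine_independent by (auto simp: vertex_sets_def)
  then show ?thesis
    using assms K affine_independent_subset by (auto simp: vertex_sets_def simplicial_complex_def)
qed

text \<open>The intersection is a face of both simplices, hence spanned by a subset of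
  \<open>S\<close> and by a subset of \<open>T\<close>; affinely independent sets with the same hull
  coincide.\<close>

lemma convex_hull_Int_vertex_sets:
  assumes "S \<in> vertex_sets K" "T \<in> vertex_sets K"
  shows "convex hull S \<inter> convex hull T = convex hull (S \<inter> T)"
proof
  have ind: "\<not> affine_dependent S" "\<not> affine_dependent T"
    using assms by (auto simp: vertex_sets_def)
  have "convex hull S \<inter> convex hull T face_of convex hull S"
       "convex hull T \<inter> convex hull S face_of convex hull T"
    using assms K by (auto simp: vertex_sets_def simplicial_complex_def)
  then obtain A B where A: "A \<subseteq> S" "convex hull S \<inter> convex hull T = convex hull A"
    and B: "B \<subseteq> T" "convex hull T \<inter> convex hull S = convex hull B"
    using face_of_convex_hull_affine_independent ind by metis
  have "A = B"
    using A B ind affine_independent_subset convex_hull_affine_independent_inject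
    by (metis Int_commute)
  then show "convex hull S \<inter> convex hull T \<subseteq> convex hull (S \<inter> T)"
    using A B by (metis hull_mono Int_greatest)
qed (simp add: hull_mono)

text \<open>A point in two simplices lies in the hull of their common vertices. Its weights there,
  extended by 0, are its weights in either simplex.\<close>

lemma bary_eqI:
  assumes T: "T \<in> vertex_sets K" and u: "barycentric T u x"
  shows "bary K v x = u v"
proof -
  have x: "x \<in> convex hull T"
    using barycentric_imp_convex_hull[OF vertex_sets_finite[OF T] u] .
  have "u' = u" if S: "S \<in> vertex_sets K" and u': "barycentric S u' x" for S u'
  proof -
    have "x \<in> convex hull S"
      using barycentric_imp_convex_hull[OF vertex_sets_finite[OF S] u'] .
    then have "x \<in> convex hull (S \<inter> T)"
      using x convex_hull_Int_vertex_sets[OF S T] by blast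
    moreover have "finite (S \<inter> T)"
      using vertex_sets_finite[OF S] by simp
    ultimately obtain w where w: "barycentric (S \<inter> T) w x"
      using convex_hull_iff_barycentric by blast
    have "barycentric S w x" "barycentric T w x"
      using w S T by (auto intro: barycentric_mono vertex_sets_finite)
    moreover have "\<not> affine_dependent S" "\<not> affine_dependent T"
      using S T by (simp_all add: vertex_sets_def)
    ultimately show ?thesis
      using barycentric_unique u u' by metis
  qed
  then have "(THE u. \<exists>T\<in>vertex_sets K. barycentric T u x) = u"
    using T u by (intro the_equality) blast+
  moreover have "x \<in> \<Union>K"
    using x T Union_complex by blast
  ultimately show ?thesis
    by (simp add: bary_def)
qed

lemma barycentric_bary:
  assumes "T \<in> vertex_sets K" "x \<in> convex hull T"
  shows "barycentric T (\<lambda>v. bary K v x) x"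
proof -
  obtain u where "barycentric T u x"
    using assms(2) convex_hull_iff_barycentric[OF vertex_sets_finite[OF assms(1)]] by blast
  moreover from this have "(\<lambda>v. bary K v x) = u"
    using bary_eqI[OF assms(1)] by (simp add: fun_eq_iff)
  ultimately show ?thesis
    by simp
qed

text \<open>The support of the coordinates is the vertex set of the carrier of \<open>x\<close>, the
  smallest simplex containing it.\<close>

lemma bary_support:
  assumes "x \<in> \<Union>K"
  shows "{v. bary K v x \<noteq> 0} \<in> vertex_sets K"
    and "barycentric {v. bary K v x \<noteq> 0} (\<lambda>v. bary K v x) x"
proof -
  obtain S where S: "S \<in> vertex_sets K" "x \<in> convex hull S"
    using assms Union_complex by blast
  then have u: "barycentric S (\<lambda>v. bary K v x) x"
    using barycentric_bary by blast
  then have sub: "{v. bary K v x \<noteq> 0} \<subseteq> S"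
    by (auto simp: barycentric_def)
  then show "{v. bary K v x \<noteq> 0} \<in> vertex_sets K"
    using S vertex_sets_subset by blast
  show "barycentric {v. bary K v x \<noteq> 0} (\<lambda>v. bary K v x) x"
    using barycentric_restrict[OF u sub vertex_sets_finite[OF S(1)]] by simp
qed

lemma convex_hull_iff_bary_support:
  assumes "x \<in> \<Union>K" "T \<in> vertex_sets K"
  shows "x \<in> convex hull T \<longleftrightarrow> {v. bary K v x \<noteq> 0} \<subseteq> T"
proof
  assume "x \<in> convex hull T"
  then have "barycentric T (\<lambda>v. bary K v x) x"
    using assms barycentric_bary by blast
  then show "{v. bary K v x \<noteq> 0} \<subseteq> T"
    by (auto simp: barycentric_def)
next
  assume "{v. bary K v x \<noteq> 0} \<subseteq> T"
  then have "barycentric T (\<lambda>v. bary K v x) x"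
    using barycentric_mono[OF bary_support(2)] assms vertex_sets_finite by metis
  then show "x \<in> convex hull T"
    using barycentric_imp_convex_hull[OF vertex_sets_finite[OF assms(2)]] by blast
qed

lemma bary_nonneg: "0 \<le> bary K v x"
proof (cases "x \<in> \<Union>K")
  case True
  then show ?thesis
    using bary_support(2)[OF True] by (cases "bary K v x = 0") (auto simp: barycentric_def)
qed (simp add: bary_def)

lemma bary_vertex:
  assumes "v \<in> \<Union>(vertex_sets K)"
  shows "bary K w v = (if w = v then 1 else 0)"
proof -
  obtain T where T: "T \<in> vertex_sets K" "v \<in> T"
    using assms by blast
  show ?thesis
    using bary_eqI[OF T(1) barycentric_vertex[OF vertex_sets_finite[OF T(1)] T(2)]] .
qed

lemma linearizes_sum:
  assumes "linearizes K f" "x \<in> \<Union>K" "finite V" "\<Union>(vertex_sets K) \<subseteq> V"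
  shows "f x = (\<Sum>v\<in>V. bary K v x * f v)"
proof -
  define T where "T = {v. bary K v x \<noteq> 0}"
  have T: "T \<in> vertex_sets K" "barycentric T (\<lambda>v. bary K v x) x"
    using bary_support assms(2) by (auto simp: T_def)
  have hull: "x \<in> convex hull T" "T \<subseteq> convex hull T"
    using barycentric_imp_convex_hull[OF vertex_sets_finite[OF T(1)] T(2)] hull_subset[of T convex] by auto
  obtain g where g: "affine_fun g" "\<forall>x\<in>convex hull T. f x = g x"
    using assms(1) T(1) by (auto simp: linearizes_def vertex_sets_def)
  have "f x = (\<Sum>v\<in>T. bary K v x * f v)"
  proof -
    have "f v = g v" if "v \<in> T" for v
      using g(2) hull(2) that by blast
    then show ?thesis
      using affine_fun_barycentric[OF g(1) T(2)] g(2) hull(1) by simp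
  qed
  also have "\<dots> = (\<Sum>v\<in>V. bary K v x * f v)"
    using assms T(1) by (intro sum.mono_neutral_left) (auto simp: T_def)
  finally show ?thesis .
qed

lemma linearizes_bary: "linearizes K (bary K v)"
  unfolding linearizes_def
proof
  fix S assume "S \<in> K"
  then obtain T where T: "T \<in> vertex_sets K" "S = convex hull T"
    using convex_hull_vertex_sets by blast
  have ind: "\<not> affine_dependent T"
    using T(1) by (simp add: vertex_sets_def)
  obtain g where g: "affine_fun g" "\<And>w. w \<in> T \<Longrightarrow> g w = (if w = v then 1 else 0)"
    using affine_interpolation[OF ind, of "\<lambda>w. if w = v then 1 else 0"] by blast
  have "bary K v x = g x" if "x \<in> S" for x
  proof -
    have u: "barycentric T (\<lambda>v. bary K v x) x"
      using barycentric_bary T that by blast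
    have "g x = (\<Sum>w\<in>T. if w = v then bary K w x else 0)"
      unfolding affine_fun_barycentric[OF g(1) u] by (rule sum.cong) (auto simp: g(2))
    also have "\<dots> = bary K v x"
      using u vertex_sets_finite[OF T(1)] by (simp add: barycentric_def)
    finally show ?thesis ..
  qed
  then show "\<exists>g. affine_fun g \<and> (\<forall>x\<in>S. bary K v x = g x)"
    using g(1) by blast
qed

lemma linearizes_in_nabla:
  assumes "linearizes K f" "\<And>x. x \<notin> \<Union>K \<Longrightarrow> f x = 0"
  shows "f \<in> nabla (\<Union>K)"
proof -
  obtain g where g: "\<And>S. S \<in> K \<Longrightarrow> affine_fun (g S) \<and> (\<forall>x\<in>S. f x = g S x)"
    using assms(1) unfolding linearizes_def by metis
  have fin: "finite K"
    using K by (simp add: simplicial_complex_def)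
  have "closed S" if "S \<in> K" for S
    using K that closed_simplex unfolding simplicial_complex_def by metis
  moreover have "continuous_on S f" if "S \<in> K" for S
    using affine_fun_continuous_on[of "g S" S] g[OF that] by (simp cong: continuous_on_cong)
  ultimately have "continuous_on (\<Union>K) f"
    using fin continuous_on_closed_Union[of K "\<lambda>S. S" f] by simp
  moreover have "piecewise_linear_on (\<Union>K) f"
    using fin g by (intro piecewise_linear_onI[of "g ` K"]) auto
  ultimately show ?thesis
    using assms(2) by (simp add: nabla_def)
qed

lemma vl_schauder_hat_bary:
  assumes "v \<in> \<Union>(vertex_sets K)"
  shows "vl_schauder_hat (\<Union>K) (bary K v)"
proof -
  have "bary K v \<in> nabla (\<Union>K)"
    using linearizes_in_nabla[OF linearizes_bary] by (simp add: bary_def)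
  moreover have "triangulates K (\<Union>K)"
    using K by (simp add: triangulates_def)
  moreover have "bary K v v = 1 \<and> (\<forall>y. vertex_of y K \<and> y \<noteq> v \<longrightarrow> bary K v y = 0)"
    using assms by (auto simp: vertex_of_iff bary_vertex)
  ultimately show ?thesis
    unfolding vl_schauder_hat_def using assms linearizes_bary vertex_of_iff by blast
qed

end

section \<open>Triangulations linearizing given functions\<close>

lemma affine_fun_diff: "affine_fun f \<Longrightarrow> affine_fun g \<Longrightarrow> affine_fun (\<lambda>x. f x - g x)"
  using affine_fun_add[OF _ affine_fun_scale[of g "- 1"]] by simp

lemma affine_fun_inner:
  assumes "affine_fun f"
  obtains a b where "f = (\<lambda>x. a \<bullet> x + b)"
proof -
  obtain l c where l: "linear l" "f = (\<lambda>x. l x + c)"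
    using assms by (auto simp: affine_fun_def)
  have "l x = adjoint l 1 \<bullet> x" for x
    using adjoint_works[OF l(1), of x 1] by (simp add: inner_commute)
  then show ?thesis
    using l(2) that[of "adjoint l 1" c] by simp
qed

lemma affine_fun_segment:
  assumes "affine_fun f"
  shows "f ((1 - t) *\<^sub>R x + t *\<^sub>R y) = (1 - t) * f x + t * f y"
proof -
  obtain l c where l: "linear l" "f = (\<lambda>x. l x + c)"
    using assms by (auto simp: affine_fun_def)
  then show ?thesis
    by (simp add: linear_add[OF l(1)] linear_cmul[OF l(1)] algebra_simps del: scaleR_diff_left)
qed

text \<open>The segment from \<open>x\<close> to the relative interior point \<open>z\<close> can be
  prolonged beyond \<open>z\<close> inside \<open>X\<close>; a positive value at \<open>x\<close>
  would make \<open>f\<close> negative there.\<close>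

lemma affine_fun_nonneg_eq_0:
  assumes "affine_fun f" "convex X" "\<And>x. x \<in> X \<Longrightarrow> 0 \<le> f x"
    and z: "z \<in> rel_interior X" "f z = 0" and x: "x \<in> X"
  shows "f x = 0"
proof -
  obtain e where e: "e > 1" "(1 - e) *\<^sub>R x + e *\<^sub>R z \<in> X"
    using convex_rel_interior_iff[of X z] assms by blast
  have "0 \<le> (1 - e) * f x"
    using assms(3)[OF e(2)] affine_fun_segment[OF assms(1), of e x z] z(2) by simp
  then have "f x \<le> 0"
    using e(1) by (simp add: zero_le_mult_iff)
  then show ?thesis
    using assms(3)[OF x] by simp
qed

text \<open>
  Two members of \<open>F\<close> that agree at a single relative interior point agree on all of \<open>X\<close>, so the
  sets where \<open>f\<close> equals a given member partition the connected set \<open>rel_interior X\<close> into finitely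
  many closed pieces.
\<close>
lemma piecewise_linear_affine_on_cell:
  assumes X: "convex X" "closed X" "X \<noteq> {}" and f: "continuous_on X f"
    and F: "finite F" "\<And>u. u \<in> F \<Longrightarrow> affine_fun u" "\<And>x. x \<in> X \<Longrightarrow> \<exists>u\<in>F. f x = u x"
    and side: "\<And>u v. u \<in> F \<Longrightarrow> v \<in> F \<Longrightarrow> (\<forall>x\<in>X. u x \<le> v x) \<or> (\<forall>x\<in>X. v x \<le> u x)"
  shows "\<exists>u\<in>F. \<forall>x\<in>X. f x = u x"
proof -
  let ?R = "rel_interior X"
  have R: "?R \<subseteq> X" "connected ?R" "?R \<noteq> {}"
    using X rel_interior_subset rel_interior_eq_empty
    by (auto simp: convex_connected convex_rel_interior)
  have agree: "u x = v x" if uv: "u \<in> F" "v \<in> F" "z \<in> ?R" "u z = v z" "x \<in> X" for u v z x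
    using side[OF uv(1,2)]
  proof
    assume "\<forall>x\<in>X. u x \<le> v x"
    then show ?thesis
      using affine_fun_nonneg_eq_0[OF affine_fun_diff[OF F(2) F(2)], of v u X z x] uv X(1) by simp
  next
    assume "\<forall>x\<in>X. v x \<le> u x"
    then show ?thesis
      using affine_fun_nonneg_eq_0[OF affine_fun_diff[OF F(2) F(2)], of u v X z x] uv X(1) by simp
  qed
  obtain z where z: "z \<in> ?R"
    using R(3) by blast
  obtain u where u: "u \<in> F" "f z = u z"
    using F(3)[of z] z R(1) by blast
  define E where "E v = {x \<in> ?R. f x = v x}" for v
  \<comment> \<open>The points governed by a member of \<open>F\<close> that differs from
    \<open>u\<close> at \<open>z\<close>. By \<open>agree\<close> this set is disjoint from
    \<open>E u\<close>, so connectedness empties it.\<close>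
  define D where "D = \<Union>(E ` {v \<in> F. v z \<noteq> u z})"
  have cl: "closedin (top_of_set ?R) (E v)" if "v \<in> F" for v
  proof -
    have "continuous_on ?R (\<lambda>x. f x - v x)"
      using f R(1) affine_fun_continuous_on[OF F(2)[OF that]]
      by (auto intro: continuous_on_diff continuous_on_subset)
    then have "closedin (top_of_set ?R) (?R \<inter> (\<lambda>x. f x - v x) -` {0})"
      by (rule continuous_closedin_preimage) simp
    moreover have "?R \<inter> (\<lambda>x. f x - v x) -` {0} = E v"
      by (auto simp: E_def)
    ultimately show ?thesis by simp
  qed
  have "closedin (top_of_set ?R) D"
    unfolding D_def using F(1) cl by (intro closedin_Union) auto
  moreover have "?R \<subseteq> E u \<union> D"
  proof
    fix x assume x: "x \<in> ?R"
    obtain v where v: "v \<in> F" "f x = v x"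
      using F(3)[of x] x R(1) by blast
    show "x \<in> E u \<union> D"
    proof (cases "v z = u z")
      case True
      then have "v x = u x"
        using agree[OF v(1) u(1) z] x R(1) by blast
      then show ?thesis
        using x v by (simp add: E_def)
    qed (use x v in \<open>auto simp: D_def E_def\<close>)
  qed
  moreover have "E u \<inter> D = {}"
  proof -
    have False if "x \<in> ?R" "f x = u x" "f x = v x" "v \<in> F" "v z \<noteq> u z" for x v
      using agree[OF that(4) u(1) that(1)] that z R(1) by auto
    then show ?thesis
      by (auto simp: D_def E_def)
  qed
  moreover have "z \<in> E u"
    using z u by (simp add: E_def)
  ultimately have "D = {}"
    using R(2) cl[OF u(1)] unfolding connected_closedin by blast
  then have "f x = u x" if "x \<in> ?R" for x
    using \<open>?R \<subseteq> E u \<union> D\<close> that by (auto simp: E_def)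
  moreover have clos: "closure ?R = X"
    using convex_closure_rel_interior[OF X(1)] closure_closed[OF X(2)] by simp
  moreover have "continuous_on X (\<lambda>x. f x - u x)"
    using f affine_fun_continuous_on[OF F(2)[OF u(1)]] by (rule continuous_on_diff)
  ultimately have "f x - u x = 0" if "x \<in> X" for x
    using continuous_constant_on_closure[of ?R "\<lambda>x. f x - u x" 0 x] that by simp
  then show ?thesis
    using u(1) by auto
qed

text \<open>The simplices of \<open>K\<close> are cut along the hyperplanes where members of
  \<open>F\<close> vanish, and the resulting cells are subdivided into simplices. Each new simplex
  lies inside one cell, which has a definite side.\<close>

lemma simplicial_complex_subdivision_sides:
  fixes K :: "'a::euclidean_space set set"
  assumes K: "triangulates K P" and F: "finite F" "\<And>u. u \<in> F \<Longrightarrow> affine_fun u"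
  obtains L where "triangulates L P"
    "\<And>S u. S \<in> L \<Longrightarrow> u \<in> F \<Longrightarrow> (\<forall>x\<in>S. u x \<le> 0) \<or> (\<forall>x\<in>S. 0 \<le> u x)"
proof -
  have "\<forall>u\<in>F. \<exists>a b. u = (\<lambda>x. a \<bullet> x + b)"
    using affine_fun_inner[OF F(2)] by metis
  then obtain a b where ab: "\<forall>u\<in>F. u = (\<lambda>x. a u \<bullet> x + b u)"
    by metis
  define I where "I = (\<lambda>u. (a u, - b u)) ` F"
  have sc: "simplicial_complex K" and P: "\<Union>K = P"
    using K by (auto simp: triangulates_def)
  have poly: "polytope X" if "X \<in> K" for X
    using sc that simplex_imp_polytope unfolding simplicial_complex_def by metis
  have fin: "finite K" "finite I" and face: "\<And>X Y. X \<in> K \<Longrightarrow> Y \<in> K \<Longrightarrow> X \<inter> Y face_of X"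
    using sc F(1) by (auto simp: simplicial_complex_def I_def)
  obtain G where G: "\<Union>G = \<Union>K" "finite G" "\<forall>X\<in>G. polytope X"
      "\<forall>X\<in>G. \<forall>Y\<in>G. X \<inter> Y face_of X"
      "\<forall>X\<in>G. \<forall>x\<in>X. \<forall>y\<in>X. \<forall>a b. (a, b) \<in> I \<longrightarrow>
        a \<bullet> x \<le> b \<and> a \<bullet> y \<le> b \<or> a \<bullet> x \<ge> b \<and> a \<bullet> y \<ge> b"
    by (rule exE[OF cell_subdivision_lemma[OF fin(1) poly aff_dim_le_DIM face fin(2)]],
        assumption+, elim conjE, rule that)
  obtain L where L: "simplicial_complex L" "\<Union>L = \<Union>G" "\<And>S. S \<in> L \<Longrightarrow> \<exists>C. C \<in> G \<and> S \<subseteq> C"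
    using simplicial_subdivision_of_cell_complex[of G] G(2-4) by metis
  have "(\<forall>x\<in>S. u x \<le> 0) \<or> (\<forall>x\<in>S. 0 \<le> u x)" if S: "S \<in> L" and u: "u \<in> F" for S u
  proof -
    obtain C where C: "C \<in> G" "S \<subseteq> C"
      using L(3)[OF S] by blast
    have I: "(a u, - b u) \<in> I"
      using u by (simp add: I_def)
    have ux: "u x = a u \<bullet> x + b u" for x
      using ab u by metis
    have "u x \<le> 0 \<and> u y \<le> 0 \<or> 0 \<le> u x \<and> 0 \<le> u y" if "x \<in> S" "y \<in> S" for x y
    proof -
      have "a u \<bullet> x \<le> - b u \<and> a u \<bullet> y \<le> - b u \<or> a u \<bullet> x \<ge> - b u \<and> a u \<bullet> y \<ge> - b u"
        using G(5) C that I by blast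
      then show ?thesis
        using ux[of x] ux[of y] by linarith
    qed
    then show ?thesis
      by (meson linear)
  qed
  then show ?thesis
    using that[of L] L G(1) P by (simp add: triangulates_def)
qed

lemma linearizes_common:
  fixes P :: "'a::euclidean_space set"
  assumes "compact_polyhedron P" and \<Phi>: "finite \<Phi>" "\<Phi> \<subseteq> nabla P"
  obtains K where "triangulates K P" "\<And>f. f \<in> \<Phi> \<Longrightarrow> linearizes K f"
proof -
  obtain K0 where K0: "triangulates K0 P"
    using assms(1) by (auto simp: compact_polyhedron_def)
  have "\<exists>F. finite F \<and> (\<forall>u\<in>F. affine_fun u) \<and> (\<forall>s\<in>P. \<exists>u\<in>F. f s = u s)" if "f \<in> \<Phi>" for f
    using that \<Phi>(2) by (auto simp: nabla_def piecewise_linear_on_def)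
  then obtain F where F: "\<And>f. f \<in> \<Phi> \<Longrightarrow>
      finite (F f) \<and> (\<forall>u\<in>F f. affine_fun u) \<and> (\<forall>s\<in>P. \<exists>u\<in>F f. f s = u s)"
    by metis
  define G where "G = (\<Union>f\<in>\<Phi>. F f)"
  \<comment> \<open>Cutting along all differences of pieces orders the pieces on each simplex, as
    \<open>piecewise_linear_affine_on_cell\<close> requires.\<close>
  define D where "D = (\<lambda>(u, v) x. u x - v x) ` (G \<times> G)"
  have G: "finite G" "\<And>u. u \<in> G \<Longrightarrow> affine_fun u"
    using \<Phi>(1) F by (auto simp: G_def)
  then have "finite D" "\<And>d. d \<in> D \<Longrightarrow> affine_fun d"
    by (auto simp: D_def intro: affine_fun_diff)
  then obtain L where L: "triangulates L P"
      and sides: "\<And>S d. S \<in> L \<Longrightarrow> d \<in> D \<Longrightarrow> (\<forall>x\<in>S. d x \<le> 0) \<or> (\<forall>x\<in>S. 0 \<le> d x)"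
    using simplicial_complex_subdivision_sides[OF K0] by metis
  have "linearizes L f" if f: "f \<in> \<Phi>" for f
    unfolding linearizes_def
  proof
    fix S assume S: "S \<in> L"
    show "\<exists>g. affine_fun g \<and> (\<forall>x\<in>S. f x = g x)"
    proof (cases "S = {}")
      case True
      then show ?thesis
        using affine_fun_const by blast
    next
      case False
      obtain n where "n simplex S"
        using L S unfolding triangulates_def simplicial_complex_def by metis
      then have X: "convex S" "closed S"
        using convex_simplex closed_simplex by auto
      have "S \<subseteq> P"
        using L S by (auto simp: triangulates_def)
      moreover have "continuous_on P f"
        using f \<Phi>(2) by (auto simp: nabla_def)
      ultimately have cont: "continuous_on S f"
        using continuous_on_subset by blast
      have "(\<forall>x\<in>S. u x \<le> v x) \<or> (\<forall>x\<in>S. v x \<le> u x)" if "u \<in> F f" "v \<in> F f" for u v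
      proof -
        have "(\<lambda>x. u x - v x) \<in> D"
          using f that by (force simp: D_def G_def)
        then show ?thesis
          using sides[OF S] by fastforce
      qed
      then have "\<exists>u\<in>F f. \<forall>x\<in>S. f x = u x"
        using F[OF f] \<open>S \<subseteq> P\<close>
        by (intro piecewise_linear_affine_on_cell[OF X False cont]) auto
      then show ?thesis
        using F[OF f] by blast
    qed
  qed
  then show ?thesis
    using that L by blast
qed

section \<open>Stellar subdivisions\<close>

lemma affine_independent_if_barycentric_unique:
  fixes T :: "'a::euclidean_space set"
  assumes fin: "finite T"
    and unique: "\<And>u u' x. barycentric T u x \<Longrightarrow> barycentric T u' x \<Longrightarrow> u = u'"
  shows "\<not> affine_dependent T"
proof
  assume "affine_dependent T"
  then obtain U w where U: "sum U T = 0" "w \<in> T" "U w \<noteq> 0" "(\<Sum>v\<in>T. U v *\<^sub>R v) = 0"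
    unfolding affine_dependent_explicit_finite[OF fin] by blast
  define M where "M = (\<Sum>v\<in>T. \<bar>U v\<bar>)"
  have le: "\<bar>U v\<bar> \<le> M" if "v \<in> T" for v
    unfolding M_def using fin that by (intro member_le_sum) auto
  have M: "0 < M"
    using le[OF U(2)] U(3) by linarith
  define n where "n = real (card T)"
  have n: "0 < n"
    using U(2) fin by (auto simp: n_def card_gt_0_iff)
  \<comment> \<open>The uniform weights for \<open>s = 0\<close>, perturbed along the dependence
    \<open>U\<close> for \<open>s = 1\<close>. Since \<open>\<bar>U v\<bar> \<le> M\<close>, the
    factor \<open>1 / (n * M)\<close> keeps the weights nonnegative, and the represented point stays
    the same.\<close>
  define u where "u s v = (if v \<in> T then 1 / n + s * U v / (n * M) else 0)" for s v
  have "barycentric T (u s) (\<Sum>v\<in>T. (1 / n) *\<^sub>R v)" if s: "s = 0 \<or> s = 1" for s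
  proof -
    have "0 \<le> 1 / n + s * U v / (n * M)" if "v \<in> T" for v
    proof -
      have "- M \<le> s * U v"
        using le[OF that] s by auto
      then have "0 \<le> (M + s * U v) / (n * M)"
        using n M by simp
      also have "\<dots> = 1 / n + s * U v / (n * M)"
        using n M by (simp add: field_simps)
      finally show ?thesis .
    qed
    moreover have "(\<Sum>v\<in>T. 1 / n + s * U v / (n * M)) = 1"
    proof -
      have "(\<Sum>v\<in>T. s * U v / (n * M)) = s * sum U T / (n * M)"
        by (simp only: sum_distrib_left sum_divide_distrib)
      then show ?thesis
        using U(1) n by (simp add: sum.distrib n_def)
    qed
    moreover have "(\<Sum>v\<in>T. (1 / n + s * U v / (n * M)) *\<^sub>R v) = (\<Sum>v\<in>T. (1 / n) *\<^sub>R v)"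
    proof -
      have "(\<Sum>v\<in>T. (s * U v / (n * M)) *\<^sub>R v) = (s / (n * M)) *\<^sub>R (\<Sum>v\<in>T. U v *\<^sub>R v)"
        by (simp add: scaleR_sum_right)
      then show ?thesis
        using U(4) by (simp add: scaleR_add_left sum.distrib)
    qed
    ultimately show ?thesis
      by (simp add: barycentric_def u_def)
  qed
  then have "u 0 = u 1"
    using unique by blast
  then have "u 0 w = u 1 w"
    by simp
  then show False
    using U n M by (simp add: u_def)
qed

text \<open>
  A family of finite sets spans a simplicial complex as soon as there are global barycentric
  coordinates: a point common to two simplices then has its support in both vertex sets.
\<close>
lemma simplicial_complex_if_coordinates:
  fixes L :: "'a::euclidean_space set set" and c :: "'a \<Rightarrow> 'a \<Rightarrow> real"
  assumes L: "finite L" "\<And>T. T \<in> L \<Longrightarrow> finite T" "\<And>S T. T \<in> L \<Longrightarrow> S \<subseteq> T \<Longrightarrow> S \<in> L"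
    and c: "\<And>T u x v. T \<in> L \<Longrightarrow> barycentric T u x \<Longrightarrow> c v x = u v"
  shows "simplicial_complex (((hull) convex) ` L)"
    and "vertex_sets (((hull) convex) ` L) = L"
proof -
  have ind: "\<not> affine_dependent T" if "T \<in> L" for T
  proof (rule affine_independent_if_barycentric_unique[OF L(2)[OF that]])
    fix u u' x assume "barycentric T u x" "barycentric T u' x"
    then show "u = u'"
      using c[OF that] by (metis ext)
  qed
  have face: "convex hull S \<inter> convex hull T face_of convex hull S" if ST: "S \<in> L" "T \<in> L" for S T
  proof -
    have "convex hull S \<inter> convex hull T \<subseteq> convex hull (S \<inter> T)"
    proof
      fix x assume "x \<in> convex hull S \<inter> convex hull T"
      then obtain u u' where u: "barycentric S u x" and u': "barycentric T u' x"
        using convex_hull_iff_barycentric[OF L(2)[OF ST(1)]]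
          convex_hull_iff_barycentric[OF L(2)[OF ST(2)]] by blast
      have "u v = u' v" for v
        using c[OF ST(1) u] c[OF ST(2) u'] by metis
      then have "{v. u v \<noteq> 0} \<subseteq> S \<inter> T"
        using u u' by (auto simp: barycentric_def)
      then have "barycentric (S \<inter> T) u x"
        using barycentric_restrict[OF u] L(2)[OF ST(1)] by blast
      then show "x \<in> convex hull (S \<inter> T)"
        using barycentric_imp_convex_hull L(2)[OF ST(1)] by blast
    qed
    then have "convex hull S \<inter> convex hull T = convex hull (S \<inter> T)"
      by (simp add: hull_mono subset_antisym)
    then show ?thesis
      using face_of_convex_hull_affine_independent[OF ind[OF ST(1)]] by blast
  qed
  show "simplicial_complex (((hull) convex) ` L)"
    unfolding simplicial_complex_def
  proof (intro conjI ballI allI impI)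
    show "finite (((hull) convex) ` L)"
      using L(1) by simp
  next
    fix S assume "S \<in> ((hull) convex) ` L"
    then obtain T where T: "T \<in> L" "S = convex hull T"
      by blast
    then show "\<exists>n. n simplex S"
      using ind[OF T(1)] by (intro exI[of _ "int (card T) - 1"]) (auto simp: simplex_def)
  next
    fix F S assume "S \<in> ((hull) convex) ` L \<and> F face_of S"
    then obtain T where T: "T \<in> L" "F face_of convex hull T"
      by blast
    then obtain R where "R \<subseteq> T" "F = convex hull R"
      using face_of_convex_hull_affine_independent[OF ind[OF T(1)]] by blast
    then show "F \<in> ((hull) convex) ` L"
      using L(3)[OF T(1)] by blast
  next
    fix S S' assume "S \<in> ((hull) convex) ` L \<and> S' \<in> ((hull) convex) ` L"
    then show "S \<inter> S' face_of S"
      using face by blast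
  qed
  show "vertex_sets (((hull) convex) ` L) = L"
  proof
    show "vertex_sets (((hull) convex) ` L) \<subseteq> L"
    proof
      fix T assume "T \<in> vertex_sets (((hull) convex) ` L)"
      then obtain S where "S \<in> L" "\<not> affine_dependent T" "convex hull T = convex hull S"
        by (auto simp: vertex_sets_def)
      then show "T \<in> L"
        using convex_hull_affine_independent_inject[of T S] ind by metis
    qed
  qed (use ind in \<open>auto simp: vertex_sets_def\<close>)
qed

text \<open>The classical subdivision on the level of vertex sets: the open star of \<open>B\<close>
  is replaced by the cone with apex \<open>b\<close> over the simplices of the closed star that do
  not contain \<open>B\<close>.\<close>

definition stellar :: "'a::euclidean_space set set \<Rightarrow> 'a set \<Rightarrow> 'a \<Rightarrow> 'a set set"
  where "stellar K B b =
    {T \<in> vertex_sets K. \<not> B \<subseteq> T} \<union> insert b ` {T \<in> vertex_sets K. \<not> B \<subseteq> T \<and> T \<union> B \<in> vertex_sets K}"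

text \<open>The infimum of the hats of the vertices in \<open>B\<close>. It is also formed for sets
  \<open>B\<close> that span no simplex.\<close>

definition min_bary :: "'a::euclidean_space set set \<Rightarrow> 'a set \<Rightarrow> 'a \<Rightarrow> real"
  where "min_bary K B x = Min ((\<lambda>v. bary K v x) ` B)"

context
  fixes K :: "'a::euclidean_space set set" and B :: "'a set" and b :: 'a
  assumes K: "simplicial_complex K" and B: "B \<in> vertex_sets K" "B \<noteq> {}"
    and b: "b = (\<Sum>v\<in>B. (1 / real (card B)) *\<^sub>R v)"
begin

private definition "n = real (card B)"
private definition "m x = min_bary K B x"

text \<open>
  Passing to the stellar subdivision at \<open>b\<close> moves the common part \<open>m x\<close> of the coordinates of \<open>x\<close>
  along \<open>B\<close> to the new vertex \<open>b\<close>. If \<open>B = {b}\<close> nothing changes.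
\<close>
private definition "c v x = bary K v x + (if v = b then n * m x else 0) - (if v \<in> B then m x else 0)"

private lemma finite_B: "finite B"
  by (rule vertex_sets_finite[OF B(1)])

private lemma n_pos: "0 < n"
  using B finite_B by (simp add: n_def card_gt_0_iff)

private lemma barycentric_b: "barycentric B (\<lambda>v. if v \<in> B then 1 / n else 0) b"
  using n_pos by (simp add: barycentric_def b n_def)

text \<open>The coordinates of the barycenter are \<open>1 / n\<close> on all of \<open>B\<close>,
  whereas a vertex has a single nonzero coordinate, at itself.\<close>

private lemma b_vertex:
  assumes "b \<in> \<Union>(vertex_sets K)"
  shows "B = {b}"
proof -
  have "v = b" if "v \<in> B" for v
    using bary_eqI[OF K B(1) barycentric_b, of v] bary_vertex[OF K assms, of v] that n_pos
    by (auto split: if_splits)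
  then show ?thesis
    using B(2) by blast
qed

private lemma b_cases: "B = {b} \<or> b \<notin> \<Union>(vertex_sets K) \<and> b \<notin> B"
proof (cases "b \<in> \<Union>(vertex_sets K)")
  case False
  then show ?thesis
    using B(1) by blast
qed (use b_vertex in simp)

private lemma m_le: "v \<in> B \<Longrightarrow> m x \<le> bary K v x"
  using finite_B by (simp add: m_def min_bary_def)

private lemma m_attained: "\<exists>v\<in>B. bary K v x = m x"
proof -
  have "m x \<in> (\<lambda>v. bary K v x) ` B"
    unfolding m_def min_bary_def using finite_B B(2) by (intro Min_in) auto
  then show ?thesis
    by force
qed

private lemma m_eqI:
  assumes "\<And>v. v \<in> B \<Longrightarrow> r \<le> bary K v x" "w \<in> B" "bary K w x = r"
  shows "m x = r"
proof -
  obtain v where "v \<in> B" "bary K v x = m x"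
    using m_attained by blast
  then show ?thesis
    using m_le[OF assms(2), of x] assms(1)[of v] assms(3) by linarith
qed

private lemma m_nonneg: "0 \<le> m x"
proof -
  obtain v where "bary K v x = m x"
    using m_attained by blast
  then show ?thesis
    using bary_nonneg[OF K, of v x] by simp
qed

private lemma bary_nonvertex:
  assumes "v \<notin> \<Union>(vertex_sets K)"
  shows "bary K v x = 0"
proof (cases "x \<in> \<Union>K")
  case True
  then show ?thesis
    using bary_support(1)[OF K True] assms by blast
qed (simp add: bary_def)

text \<open>If \<open>B = {b}\<close> then \<open>n = 1\<close> and the correction terms cancel;
  otherwise \<open>b\<close> is a new vertex and \<open>bary K b\<close> vanishes.\<close>

private lemma c_b: "c b x = n * m x"
proof (cases "B = {b}")
  case True
  then have "m x = bary K b x"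
    using m_attained[of x] by (metis singletonD)
  moreover have "b \<in> B" "card B = 1"
    using True by simp_all
  ultimately show ?thesis
    by (simp add: c_def n_def)
next
  case False
  then have "b \<notin> B" "bary K b x = 0"
    using b_cases bary_nonvertex by blast+
  then show ?thesis
    by (simp add: c_def)
qed

text \<open>This makes \<open>c\<close> global coordinates for the subdivision. An old simplex
  misses a vertex of \<open>B\<close>, so \<open>m x = 0\<close>. In a cone the weight of
  \<open>b\<close> is spread evenly over \<open>B\<close>, and a vertex of \<open>B\<close> outside
  the base shows that the common part is \<open>u b / n\<close>.\<close>

private lemma c_eq:
  assumes T: "T \<in> stellar K B b" and u: "barycentric T u x"
  shows "c v x = u v"
proof (cases "T \<in> vertex_sets K \<and> \<not> B \<subseteq> T")
  case True
  then obtain w where w: "w \<in> B" "w \<notin> T"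
    by blast
  have bu: "bary K v x = u v" for v
    using bary_eqI[OF K _ u] True by simp
  have "bary K w x = 0"
    using bu w u by (simp add: barycentric_def)
  then have "m x = 0"
    using m_eqI[OF bary_nonneg[OF K] w(1)] by blast
  then show ?thesis
    using bu by (simp add: c_def)
next
  case False
  then obtain S where S: "T = insert b S" "S \<in> vertex_sets K" "\<not> B \<subseteq> S" "S \<union> B \<in> vertex_sets K"
    using T by (auto simp: stellar_def)
  have bS: "b \<notin> S"
    using b_cases S by blast
  have fin: "finite S"
    using S vertex_sets_finite by blast
  \<comment> \<open>The weights of \<open>x\<close> in \<open>S \<union> B\<close>, obtained by
    substituting for \<open>b\<close> the average of \<open>B\<close>.\<close>
  define w where "w v = (if v \<in> S then u v else 0) + (if v \<in> B then u b / n else 0)" for v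
  have ub: "0 \<le> u b / n"
    using u n_pos S(1) by (simp add: barycentric_def)
  have "barycentric (S \<union> B) w x"
    unfolding barycentric_def
  proof (intro conjI ballI allI impI)
    show "0 \<le> w v" if "v \<in> S \<union> B" for v
      using u ub S(1) by (auto simp: w_def barycentric_def)
    show "w v = 0" if "v \<notin> S \<union> B" for v
      using that by (simp add: w_def)
    have "(\<Sum>v\<in>S \<union> B. if v \<in> S then u v else 0) = sum u S"
      using fin finite_B by (simp add: sum.If_cases Int_absorb1)
    moreover have "(\<Sum>v\<in>S \<union> B. if v \<in> B then u b / n else 0) = u b"
      using fin finite_B B(2) by (simp add: sum.If_cases Int_absorb1 n_def)
    ultimately show "sum w (S \<union> B) = 1"
      using u S(1) bS fin by (simp add: w_def sum.distrib barycentric_def)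
    have "(\<Sum>v\<in>S \<union> B. (if v \<in> S then u v else 0) *\<^sub>R v) = (\<Sum>v\<in>S. u v *\<^sub>R v)"
      using fin finite_B by (intro sum.mono_neutral_cong_right) auto
    moreover have "(\<Sum>v\<in>S \<union> B. (if v \<in> B then u b / n else 0) *\<^sub>R v) = (\<Sum>v\<in>B. (u b / n) *\<^sub>R v)"
      using fin finite_B by (intro sum.mono_neutral_cong_right) auto
    moreover have "(\<Sum>v\<in>B. (u b / n) *\<^sub>R v) = u b *\<^sub>R b"
      by (simp add: b n_def scaleR_sum_right)
    ultimately show "(\<Sum>v\<in>S \<union> B. w v *\<^sub>R v) = x"
      using u S(1) bS fin by (simp add: w_def scaleR_add_left sum.distrib barycentric_def add.commute)
  qed
  note bw = bary_eqI[OF K S(4) this]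
  obtain v0 where v0: "v0 \<in> B" "v0 \<notin> S"
    using S(3) by blast
  have "m x = u b / n"
  proof (rule m_eqI[OF _ v0(1)])
    show "bary K v0 x = u b / n"
      using v0 by (simp add: bw w_def)
    show "u b / n \<le> bary K v x" if "v \<in> B" for v
      using that u S(1) by (simp add: bw w_def barycentric_def)
  qed
  then show ?thesis
    using bw[of v] u S(1) bS n_pos by (simp add: c_def w_def barycentric_def)
qed

private lemma finite_stellar: "T \<in> stellar K B b \<Longrightarrow> finite T"
  unfolding stellar_def by (auto dest: vertex_sets_finite)

private lemma stellar_subset:
  assumes T: "T \<in> stellar K B b" and S: "S \<subseteq> T"
  shows "S \<in> stellar K B b"
proof (cases "S \<in> vertex_sets K \<and> \<not> B \<subseteq> S")
  case False
  have "\<not> (T \<in> vertex_sets K \<and> \<not> B \<subseteq> T)"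
    using False vertex_sets_subset[OF K _ S] S by blast
  then obtain R where R: "T = insert b R" "R \<in> vertex_sets K" "\<not> B \<subseteq> R" "R \<union> B \<in> vertex_sets K"
    using T by (auto simp: stellar_def)
  have "S - {b} \<subseteq> R" "S - {b} \<union> B \<subseteq> R \<union> B"
    using S R(1) by auto
  then have *: "S - {b} \<in> vertex_sets K" "S - {b} \<union> B \<in> vertex_sets K" "\<not> B \<subseteq> S - {b}"
    using vertex_sets_subset[OF K] R by blast+
  have "b \<in> S"
  proof (rule ccontr)
    assume "b \<notin> S"
    then show False
      using False * by simp
  qed
  moreover have "insert b (S - {b}) \<in> stellar K B b"
    unfolding stellar_def using * by (intro UnI2 imageI) simp
  ultimately show ?thesis
    by (simp add: insert_absorb)
qed (simp add: stellar_def)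

private lemma Union_stellar: "\<Union>(((hull) convex) ` stellar K B b) = \<Union>K"
proof
  show "\<Union>(((hull) convex) ` stellar K B b) \<subseteq> \<Union>K"
  proof
    fix x assume "x \<in> \<Union>(((hull) convex) ` stellar K B b)"
    then obtain T where T: "T \<in> stellar K B b" "x \<in> convex hull T"
      by blast
    show "x \<in> \<Union>K"
    proof (cases "T \<in> vertex_sets K")
      case True
      then show ?thesis
        using T(2) by (auto simp: vertex_sets_def)
    next
      case False
      then obtain R where R: "T = insert b R" "R \<union> B \<in> vertex_sets K"
        using T(1) by (auto simp: stellar_def)
      have "b \<in> convex hull B"
        using barycentric_imp_convex_hull[OF finite_B barycentric_b] .
      then have "b \<in> convex hull (R \<union> B)"
        using hull_mono[of B "R \<union> B" convex] by blast
      moreover have "R \<subseteq> convex hull (R \<union> B)"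
        using hull_subset[of "R \<union> B" convex] by blast
      ultimately have "convex hull T \<subseteq> convex hull (R \<union> B)"
        unfolding R(1) by (intro hull_minimal) auto
      then show ?thesis
        using T(2) R(2) by (auto simp: vertex_sets_def)
    qed
  qed
next
  show "\<Union>K \<subseteq> \<Union>(((hull) convex) ` stellar K B b)"
  proof
    fix x assume x: "x \<in> \<Union>K"
    define S where "S = {v. bary K v x \<noteq> 0}"
    have S: "S \<in> vertex_sets K" "barycentric S (\<lambda>v. bary K v x) x"
      using bary_support[OF K x] by (simp_all add: S_def)
    have fin: "finite S"
      using vertex_sets_finite[OF S(1)] .
    show "x \<in> \<Union>(((hull) convex) ` stellar K B b)"
    proof (cases "B \<subseteq> S")
      case False
      then show ?thesis
        using S barycentric_imp_convex_hull[OF fin] by (auto simp: stellar_def)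
    next
      case BS: True
      \<comment> \<open>Moving the weight \<open>m x\<close> of every vertex of \<open>B\<close> to
        \<open>b\<close> empties exactly the vertices where the minimum is attained;
        \<open>R\<close> keeps the others and therefore cannot contain \<open>B\<close>.\<close>
      define R where "R = S - {v \<in> B. bary K v x = m x}"
      have R: "R \<subseteq> S" "\<not> B \<subseteq> R" "R \<union> B \<subseteq> S"
        using BS m_attained[of x] by (auto simp: R_def)
      then have T: "insert b R \<in> stellar K B b"
        using S(1) vertex_sets_subset[OF K S(1)] by (auto simp: stellar_def)
      have bR: "b \<notin> R"
        using b_cases R S(1) by blast
      let ?d = "\<lambda>v. bary K v x - (if v \<in> B then m x else 0)"
      have cd: "c v x = ?d v" if "v \<in> R" for v
        using that bR by (auto simp: c_def)
      have finR: "finite R"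
        using fin R(1) finite_subset by blast
      have zero: "?d v = 0" if "v \<in> S - R" for v
        using that by (auto simp: R_def)
      have "barycentric (insert b R) (\<lambda>v. if v \<in> insert b R then c v x else 0) x"
        unfolding barycentric_def
      proof (intro conjI ballI allI impI)
        show "0 \<le> (if v \<in> insert b R then c v x else 0)" if "v \<in> insert b R" for v
          using that cd m_le[of v x] bary_nonneg[OF K, of v x] n_pos m_nonneg[of x]
          by (auto simp: c_b)
        have "(\<Sum>v\<in>R. c v x) = (\<Sum>v\<in>S. ?d v)"
          using fin R(1) cd zero by (intro sum.mono_neutral_cong_left) auto
        also have "\<dots> = 1 - n * m x"
          using S(2) BS fin by (simp add: sum_subtractf barycentric_def sum.If_cases Int_absorb1 n_def)
        finally show "sum (\<lambda>v. if v \<in> insert b R then c v x else 0) (insert b R) = 1"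
          using finR bR by (simp add: c_b cong: sum.cong)
        have "(\<Sum>v\<in>R. c v x *\<^sub>R v) = (\<Sum>v\<in>S. ?d v *\<^sub>R v)"
          using fin R(1) cd zero by (intro sum.mono_neutral_cong_left) auto
        also have "\<dots> = x - (\<Sum>v\<in>S. (if v \<in> B then m x else 0) *\<^sub>R v)"
          using S(2) by (simp add: scaleR_diff_left sum_subtractf barycentric_def)
        also have "(\<Sum>v\<in>S. (if v \<in> B then m x else 0) *\<^sub>R v) = (\<Sum>v\<in>B. m x *\<^sub>R v)"
          using fin BS by (intro sum.mono_neutral_cong_right) auto
        also have "\<dots> = (n * m x) *\<^sub>R b"
          using n_pos by (simp add: b n_def scaleR_sum_right)
        finally show "(\<Sum>v\<in>insert b R. (if v \<in> insert b R then c v x else 0) *\<^sub>R v) = x"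
          using finR bR by (simp add: c_b cong: sum.cong)
      qed simp
      then have "x \<in> convex hull (insert b R)"
        using barycentric_imp_convex_hull finR by blast
      then show ?thesis
        using T by blast
    qed
  qed
qed

lemma vl_schauder_hat_min_bary_aux: "vl_schauder_hat (\<Union>K) (\<lambda>x. real (card B) * min_bary K B x)"
proof -
  define L where "L = ((hull) convex) ` stellar K B b"
  have fin: "finite (stellar K B b)"
    using finite_vertex_sets[OF K] by (simp add: stellar_def)
  have L: "simplicial_complex L" "vertex_sets L = stellar K B b"
    unfolding L_def
    by (rule simplicial_complex_if_coordinates[where c = c], rule fin, erule finite_stellar,
        erule (1) stellar_subset, erule (1) c_eq)+
  have UL: "\<Union>L = \<Union>K"
    using Union_stellar by (simp add: L_def)
  obtain v where v: "v \<in> B"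
    using B(2) by blast
  \<comment> \<open>The cone over the facet \<open>B - {v}\<close> witnesses that \<open>b\<close>
    is a vertex of \<open>L\<close>; for a singleton \<open>B\<close> the facet is empty and the
    cone is \<open>{b}\<close>.\<close>
  have "B - {v} \<union> B = B"
    by blast
  then have "B - {v} \<in> vertex_sets K" "\<not> B \<subseteq> B - {v}" "B - {v} \<union> B \<in> vertex_sets K"
    using v B(1) vertex_sets_subset[OF K B(1), of "B - {v}"] by auto
  then have "insert b (B - {v}) \<in> stellar K B b"
    by (auto simp: stellar_def)
  then have "b \<in> \<Union>(vertex_sets L)"
    using L(2) by blast
  moreover have "bary L b x = n * m x" for x
  proof (cases "x \<in> \<Union>L")
    case True
    show ?thesis
      using c_eq[OF _ bary_support(2)[OF L(1) True], of b] bary_support(1)[OF L(1) True] L(2)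
      by (simp add: c_b)
  next
    case False
    then have "m x = 0"
      using m_attained[of x] UL by (auto simp: bary_def)
    then show ?thesis
      using False by (simp add: bary_def)
  qed
  then have "bary L b = (\<lambda>x. real (card B) * min_bary K B x)"
    by (simp add: fun_eq_iff n_def m_def)
  ultimately show ?thesis
    using vl_schauder_hat_bary[OF L(1)] UL by metis
qed

end

text \<open>This is the hat of the new vertex of the stellar subdivision at the barycenter of \<open>B\<close>.\<close>
lemma vl_schauder_hat_min_bary:
  assumes "simplicial_complex K" "B \<in> vertex_sets K" "B \<noteq> {}"
  shows "vl_schauder_hat (\<Union>K) (\<lambda>x. real (card B) * min_bary K B x)"
  by (rule vl_schauder_hat_min_bary_aux[OF assms refl])

section \<open>Uniqueness\<close>

lemma vl_valuation_0: "vl_valuation V \<nu> \<Longrightarrow> \<nu> 0 = 0"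
  by (simp add: vl_valuation_def)

lemma vl_valuation_sup:
  "vl_valuation V \<nu> \<Longrightarrow> x \<in> V \<Longrightarrow> y \<in> V \<Longrightarrow> \<nu> (sup x y) = \<nu> x + \<nu> y - \<nu> (inf x y)"
  by (simp add: vl_valuation_def)

lemma vl_valuation_add:
  "vl_valuation V \<nu> \<Longrightarrow> x \<in> V \<Longrightarrow> y \<in> V \<Longrightarrow> 0 \<le> x \<Longrightarrow> 0 \<le> y \<Longrightarrow> \<nu> (x + y) = \<nu> (sup x y)"
  by (simp add: vl_valuation_def)

lemma vl_valuation_diff:
  "vl_valuation V \<nu> \<Longrightarrow> x \<in> V \<Longrightarrow> y \<in> V \<Longrightarrow> 0 \<le> x \<Longrightarrow> 0 \<le> y \<Longrightarrow> inf x y = 0 \<Longrightarrow>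
    \<nu> (x - y) = \<nu> x - \<nu> y"
  by (simp add: vl_valuation_def)

context
  fixes P :: "'a::euclidean_space set" and \<nu> :: "('a \<Rightarrow> real) \<Rightarrow> real"
  assumes \<nu>: "vl_valuation (nabla P) \<nu>"
begin

lemma vl_valuation_absorb:
  assumes "x \<in> nabla P" "y \<in> nabla P" "0 \<le> y" "y \<le> x"
  shows "\<nu> (x + y) = \<nu> x"
  using vl_valuation_add[OF \<nu> assms(1,2)] assms by (simp add: sup_absorb1)

lemma vl_valuation_scale:
  assumes x: "x \<in> nabla P" "0 \<le> x"
  shows "\<nu> (\<lambda>z. real (Suc k) * x z) = \<nu> x"
proof (induction k)
  case (Suc k)
  have "(\<lambda>z. real (Suc (Suc k)) * x z) = (\<lambda>z. real (Suc k) * x z) + x"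
    by (simp add: fun_eq_iff algebra_simps)
  moreover have "x \<le> (\<lambda>z. real (Suc k) * x z)"
    using x(2) by (simp add: le_fun_def distrib_right)
  ultimately show ?case
    using vl_valuation_absorb[OF nabla_scale[OF x(1)] x(1,2)] Suc.IH by metis
qed simp

text \<open>Both values equal the value at \<open>(n + 1) f + (n + 1) g\<close>. By (V3), starting
  from \<open>(n + 1) f\<close>, each further copy of \<open>g\<close> is absorbed because it is
  dominated by what is already there; the roles of \<open>f\<close> and \<open>g\<close> are
  symmetric.\<close>

lemma vl_valuation_eq_if_comparable:
  assumes f: "f \<in> nabla P" "0 \<le> f" and g: "g \<in> nabla P" "0 \<le> g"
    and fg: "\<And>z. f z \<le> real n * g z" and gf: "\<And>z. g z \<le> real n * f z"
  shows "\<nu> f = \<nu> g"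
proof -
  have *: "\<nu> (\<lambda>z. real (Suc n) * u z + real k * v z) = \<nu> u"
    if u: "u \<in> nabla P" "0 \<le> u" and v: "v \<in> nabla P" "0 \<le> v"
      and vu: "\<And>z. v z \<le> real n * u z" for u v k
  proof (induction k)
    case 0
    then show ?case
      using vl_valuation_scale[OF u] by simp
  next
    case (Suc k)
    define w where "w = (\<lambda>z. real (Suc n) * u z + real k * v z)"
    have "w \<in> nabla P"
      using nabla_add[OF nabla_scale[OF u(1)] nabla_scale[OF v(1)]]
      by (simp add: w_def plus_fun_def)
    moreover have "v \<le> w"
    proof (rule le_funI)
      fix z
      have "0 \<le> u z" "0 \<le> real k * v z"
        using u(2) v(2) by (simp_all add: le_fun_def)
      then show "v z \<le> w z"
        using vu[of z] by (simp add: w_def distrib_right)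
    qed
    ultimately have "\<nu> (w + v) = \<nu> w"
      using vl_valuation_absorb v by blast
    moreover have "w + v = (\<lambda>z. real (Suc n) * u z + real (Suc k) * v z)"
      by (simp add: w_def fun_eq_iff algebra_simps)
    ultimately show ?case
      using Suc.IH by (simp add: w_def)
  qed
  have "\<nu> f = \<nu> (\<lambda>z. real (Suc n) * f z + real (Suc n) * g z)"
    by (rule *[OF f g gf, symmetric])
  also have "\<dots> = \<nu> (\<lambda>z. real (Suc n) * g z + real (Suc n) * f z)"
    by (simp add: add.commute)
  also have "\<dots> = \<nu> g"
    by (rule *[OF g f fg])
  finally show ?thesis .
qed

end

section \<open>Suprema and infima of hats\<close>

lemma inf_foldr_sup:
  fixes x :: "'a \<Rightarrow> real"
  assumes "0 \<le> x"
  shows "inf x (foldr sup ys 0) = foldr sup (map (inf x) ys) 0"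
proof (induction ys)
  case Nil
  then show ?case
    using inf_absorb2[OF assms] by (simp only: foldr.simps list.map id_apply)
qed (simp only: foldr.simps list.map comp_apply inf_sup_distrib1)

lemma foldr_sup_in_nabla: "set ys \<subseteq> nabla P \<Longrightarrow> foldr sup ys 0 \<in> nabla P"
  by (induction ys) (auto simp: nabla_zero nabla_sup)

lemma foldr_sup_upper: "y \<in> set ys \<Longrightarrow> y \<le> foldr sup ys (0 :: 'a \<Rightarrow> real)"
  by (induction ys) (auto intro: le_supI2)

lemma foldr_sup_nonneg: "0 \<le> foldr sup ys (0 :: 'a \<Rightarrow> real)"
  by (induction ys) (simp_all only: foldr.simps id_apply comp_apply order_refl le_supI2)

lemma foldr_sup_least:
  "(\<And>y. y \<in> set ys \<Longrightarrow> y \<le> z) \<Longrightarrow> 0 \<le> z \<Longrightarrow> foldr sup ys 0 \<le> (z :: 'a \<Rightarrow> real)"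
  by (induction ys) auto

text \<open>Inclusion-exclusion through (V2). Distributivity turns the infimum of \<open>x\<close>
  with the remaining supremum into a supremum of another, equally short list from
  \<open>\<Phi>\<close>; hence the induction on length rather than on the list itself.\<close>

lemma vl_valuations_agree_on_sup:
  assumes \<nu>: "vl_valuation (nabla P) \<nu>" and \<mu>: "vl_valuation (nabla P) \<mu>"
    and \<Phi>: "\<Phi> \<subseteq> nabla P" "\<And>x. x \<in> \<Phi> \<Longrightarrow> 0 \<le> x" "\<And>x y. x \<in> \<Phi> \<Longrightarrow> y \<in> \<Phi> \<Longrightarrow> inf x y \<in> \<Phi>"
    and agree: "\<And>x. x \<in> \<Phi> \<Longrightarrow> \<nu> x = \<mu> x"
    and ys: "set ys \<subseteq> \<Phi>"
  shows "\<nu> (foldr sup ys 0) = \<mu> (foldr sup ys 0)"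
  using ys
proof (induction "length ys" arbitrary: ys)
  case 0
  then show ?case
    using vl_valuation_0[OF \<nu>] vl_valuation_0[OF \<mu>] by (simp add: zero_fun_def)
next
  case (Suc n)
  then obtain x xs where xs: "ys = x # xs" "length xs = n"
    by (cases ys) auto
  define s where "s = foldr sup xs (0 :: 'a \<Rightarrow> real)"
  have x: "x \<in> \<Phi>" "x \<in> nabla P" "s \<in> nabla P"
    using xs Suc.prems \<Phi>(1) foldr_sup_in_nabla[of xs P] by (auto simp: s_def)
  have "\<nu> s = \<mu> s"
    unfolding s_def using Suc.hyps(1)[of xs] xs Suc.prems by simp
  moreover have "inf x s = foldr sup (map (inf x) xs) 0"
    unfolding s_def by (rule inf_foldr_sup[OF \<Phi>(2)[OF x(1)]])
  then have "\<nu> (inf x s) = \<mu> (inf x s)"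
    using Suc.hyps(1)[of "map (inf x) xs"] xs Suc.prems \<Phi>(3)[OF x(1)] by auto
  ultimately have "\<nu> (sup x s) = \<mu> (sup x s)"
    using vl_valuation_sup[OF \<nu> x(2,3)] vl_valuation_sup[OF \<mu> x(2,3)] agree[OF x(1)] by simp
  then show ?case
    by (simp add: xs(1) s_def)
qed

lemma min_bary_Un:
  assumes "finite B" "B \<noteq> {}" "finite C" "C \<noteq> {}"
  shows "min_bary K (B \<union> C) = inf (min_bary K B) (min_bary K C)"
  using assms by (simp add: fun_eq_iff min_bary_def image_Un Min.union inf_min)

lemma min_bary_singleton: "min_bary K {v} = bary K v"
  by (simp add: fun_eq_iff min_bary_def)

lemma min_bary_nonneg:
  assumes "simplicial_complex K" "finite B" "B \<noteq> {}"
  shows "0 \<le> min_bary K B"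
  using assms bary_nonneg[OF assms(1)] by (simp add: le_fun_def min_bary_def)

lemma bary_in_nabla: "simplicial_complex K \<Longrightarrow> bary K v \<in> nabla (\<Union>K)"
  by (rule linearizes_in_nabla[OF _ linearizes_bary]) (auto simp: bary_def)

lemma min_bary_in_nabla:
  assumes "simplicial_complex K" "finite B" "B \<noteq> {}"
  shows "min_bary K B \<in> nabla (\<Union>K)"
  using assms(2,3)
proof (induction rule: finite_ne_induct)
  case (singleton v)
  then show ?case
    by (simp only: min_bary_singleton bary_in_nabla[OF assms(1)])
next
  case (insert v B)
  then have "min_bary K (insert v B) = inf (bary K v) (min_bary K B)"
    using min_bary_Un[of "{v}" B K] by (simp add: min_bary_singleton)
  then show ?case
    using nabla_inf[OF bary_in_nabla[OF assms(1)] insert.IH] by (simp only:)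
qed

text \<open>If all hats of \<open>B\<close> were nonzero at a point, \<open>B\<close> would be
  contained in the carrier of that point and so span a simplex.\<close>

lemma min_bary_eq_0:
  assumes K: "simplicial_complex K" and B: "finite B" "B \<noteq> {}" "B \<notin> vertex_sets K"
  shows "min_bary K B = 0"
proof
  fix x
  show "min_bary K B x = 0 x"
  proof (cases "x \<in> \<Union>K")
    case True
    then have "\<not> B \<subseteq> {v. bary K v x \<noteq> 0}"
      using vertex_sets_subset[OF K bary_support(1)[OF K True]] B(3) by blast
    then obtain v where v: "v \<in> B" "bary K v x = 0"
      by blast
    then have "min_bary K B x \<le> 0"
      unfolding min_bary_def using B(1) by (metis Min_le finite_imageI imageI)
    moreover have "0 \<le> min_bary K B x"
      using min_bary_nonneg[OF K B(1,2)] by (simp add: le_fun_def)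
    ultimately show ?thesis
      by simp
  next
    case False
    then show ?thesis
      using B by (simp add: min_bary_def bary_def image_constant_conv)
  qed
qed

text \<open>The stellar hat is \<open>card B\<close> times the infimum, and a positive integer
  factor does not change the value.\<close>

lemma vl_valuation_min_bary:
  assumes K: "simplicial_complex K" and \<nu>: "vl_valuation (nabla (\<Union>K)) \<nu>"
    and hat: "\<And>h. vl_schauder_hat (\<Union>K) h \<Longrightarrow> \<nu> h = 1"
    and B: "finite B" "B \<noteq> {}"
  shows "\<nu> (min_bary K B) = (if B \<in> vertex_sets K then 1 else 0)"
proof (cases "B \<in> vertex_sets K")
  case True
  obtain k where "card B = Suc k"
    using B by (metis card_gt_0_iff gr0_implies_Suc)
  then show ?thesis
    using vl_valuation_scale[OF \<nu> min_bary_in_nabla[OF K B] min_bary_nonneg[OF K B], of k]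
      hat[OF vl_schauder_hat_min_bary[OF K True B(2)]] True by simp
next
  case False
  have "\<nu> (min_bary K B) = 0"
    using min_bary_eq_0[OF K B False] vl_valuation_0[OF \<nu>] by metis
  then show ?thesis
    using False by simp
qed

lemma vl_valuations_agree_nonneg:
  assumes P: "compact_polyhedron P"
    and \<nu>: "vl_valuation (nabla P) \<nu>" "\<And>h. vl_schauder_hat P h \<Longrightarrow> \<nu> h = 1"
    and \<mu>: "vl_valuation (nabla P) \<mu>" "\<And>h. vl_schauder_hat P h \<Longrightarrow> \<mu> h = 1"
    and f: "f \<in> nabla P" "0 \<le> f"
  shows "\<nu> f = \<mu> f"
proof -
  obtain K where "triangulates K P" and lin: "linearizes K f"
    using linearizes_common[OF P, of "{f}"] f(1) by auto
  then have K: "simplicial_complex K" and U: "\<Union>K = P"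
    by (auto simp: triangulates_def)
  define V where "V = \<Union>(vertex_sets K)"
  have finV: "finite V"
    unfolding V_def by (rule finite_vertices[OF K])
  define \<Phi> where "\<Phi> = min_bary K ` {B. finite B \<and> B \<noteq> {}}"
  have hat_in: "bary K v \<in> \<Phi>" for v
    unfolding \<Phi>_def min_bary_singleton[symmetric] by (rule imageI) simp
  have f_nonneg: "0 \<le> f x" for x
    using f(2) by (simp add: le_fun_def)
  have "finite {v \<in> V. 0 < f v}"
    using finV by simp
  then obtain vs where vs: "set vs = {v \<in> V. 0 < f v}"
    using finite_list by blast
  define g where "g = foldr sup (map (bary K) vs) 0"
  have agree: "\<nu> g = \<mu> g"
    unfolding g_def
  proof (rule vl_valuations_agree_on_sup[OF \<nu>(1) \<mu>(1)])
    show "\<Phi> \<subseteq> nabla P"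
      using min_bary_in_nabla[OF K] U by (auto simp: \<Phi>_def)
    show "0 \<le> x" if "x \<in> \<Phi>" for x
      using that min_bary_nonneg[OF K] by (auto simp: \<Phi>_def)
    show "inf x y \<in> \<Phi>" if xy: "x \<in> \<Phi>" "y \<in> \<Phi>" for x y
    proof -
      obtain B C where BC: "x = min_bary K B" "finite B" "B \<noteq> {}" "y = min_bary K C" "finite C" "C \<noteq> {}"
        using xy by (auto simp: \<Phi>_def)
      then have "inf x y = min_bary K (B \<union> C)"
        using min_bary_Un[of B C K] by (simp only: not_False_eq_True)
      then show ?thesis
        using BC unfolding \<Phi>_def by (intro image_eqI[of _ _ "B \<union> C"]) simp_all
    qed
    show "\<nu> x = \<mu> x" if x: "x \<in> \<Phi>" for x
    proof -
      obtain B where B: "x = min_bary K B" "finite B" "B \<noteq> {}"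
        using x by (auto simp: \<Phi>_def)
      show ?thesis
        unfolding B(1)
        using vl_valuation_min_bary[OF K, of \<nu> B] vl_valuation_min_bary[OF K, of \<mu> B] \<nu> \<mu> B U
        by simp
    qed
    show "set (map (bary K) vs) \<subseteq> \<Phi>"
      using hat_in by auto
  qed
  have fsum: "f x = (\<Sum>v\<in>V. bary K v x * f v)" if "x \<in> P" for x
    using linearizes_sum[OF K lin _ finV] that U by (simp add: V_def)
  have f0: "f x = 0" if "x \<notin> P" for x
    using f(1) that by (simp add: nabla_def)
  have g: "g \<in> nabla P" "0 \<le> g"
    using foldr_sup_in_nabla[of "map (bary K) vs" P] bary_in_nabla[OF K] U
      foldr_sup_nonneg[of "map (bary K) vs"] by (auto simp: g_def)
  \<comment> \<open>The first bound gives \<open>f \<le> n g\<close>, the second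
    \<open>g \<le> n f\<close>. Where \<open>f v = 0\<close> the summand \<open>1 / f v\<close> is 0
    by convention, so all summands are nonnegative and each is at most the sum.\<close>
  obtain n where n: "sum f V \<le> real n" "(\<Sum>v\<in>V. 1 / f v) \<le> real n"
  proof -
    obtain k l where "sum f V \<le> real k" "(\<Sum>v\<in>V. 1 / f v) \<le> real l"
      using real_arch_simple by metis
    then show thesis
      using that[of "max k l"] by (simp add: of_nat_max max.coboundedI1 max.coboundedI2)
  qed
  have fg: "f x \<le> real n * g x" for x
  proof (cases "x \<in> P")
    case True
    have "bary K v x * f v \<le> g x * f v" if "v \<in> V" for v
    proof (cases "0 < f v")
      case True
      then have "bary K v \<le> g"
        unfolding g_def using that vs by (intro foldr_sup_upper) auto
      then show ?thesis
        using True by (simp add: le_fun_def)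
    next
      case False
      then show ?thesis
        using f_nonneg[of v] by simp
    qed
    then have "f x \<le> (\<Sum>v\<in>V. g x * f v)"
      unfolding fsum[OF True] by (rule sum_mono)
    also have "\<dots> = sum f V * g x"
      by (simp add: sum_distrib_left mult.commute)
    also have "\<dots> \<le> real n * g x"
      using n(1) g(2) by (intro mult_right_mono) (simp_all add: le_fun_def)
    finally show ?thesis .
  next
    case False
    then show ?thesis
      using f0 g(2) by (simp add: le_fun_def)
  qed
  have "g \<le> (\<lambda>x. real n * f x)"
    unfolding g_def
  proof (rule foldr_sup_least)
    show "0 \<le> (\<lambda>x. real n * f x)"
      using f_nonneg by (simp add: le_fun_def)
    fix y assume "y \<in> set (map (bary K) vs)"
    then obtain v where v: "v \<in> V" "0 < f v" "y = bary K v"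
      using vs by auto
    have "1 / f v \<le> (\<Sum>v\<in>V. 1 / f v)"
      using v(1) finV f_nonneg by (intro member_le_sum) auto
    then have nv: "1 / f v \<le> real n"
      using n(2) by linarith
    show "y \<le> (\<lambda>x. real n * f x)"
    proof (rule le_funI)
      fix x
      show "y x \<le> real n * f x"
      proof (cases "x \<in> P")
        case True
        have "bary K v x * f v \<le> f x"
          unfolding fsum[OF True] using v(1) finV f_nonneg bary_nonneg[OF K]
          by (intro member_le_sum) auto
        then have "bary K v x \<le> 1 / f v * f x"
          using v(2) by (simp add: field_simps)
        also have "\<dots> \<le> real n * f x"
          using nv f_nonneg by (intro mult_right_mono)
        finally show ?thesis
          by (simp add: v(3))
      next
        case False
        then show ?thesis
          using U f0 by (simp add: v(3) bary_def)
      qed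
    qed
  qed
  then have gf: "g x \<le> real n * f x" for x
    by (simp add: le_fun_def)
  show ?thesis
    using vl_valuation_eq_if_comparable[OF \<nu>(1) f g fg gf]
      vl_valuation_eq_if_comparable[OF \<mu>(1) f g fg gf] agree by simp
qed

lemma vl_valuations_agree:
  assumes P: "compact_polyhedron P"
    and \<nu>: "vl_valuation (nabla P) \<nu>" "\<And>h. vl_schauder_hat P h \<Longrightarrow> \<nu> h = 1"
    and \<mu>: "vl_valuation (nabla P) \<mu>" "\<And>h. vl_schauder_hat P h \<Longrightarrow> \<mu> h = 1"
    and f: "f \<in> nabla P"
  shows "\<nu> f = \<mu> f"
proof -
  \<comment> \<open>Positive and negative parts of \<open>f\<close>, to which (V4) applies.\<close>
  define p q where "p = sup f 0" and "q = sup (0 - f) 0"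
  have pq: "p \<in> nabla P" "0 \<le> p" "q \<in> nabla P" "0 \<le> q"
    using nabla_sup[OF f nabla_zero] nabla_sup[OF nabla_diff[OF nabla_zero f] nabla_zero]
    by (simp_all only: p_def q_def sup_ge2)
  have "f = p - q" "inf p q = 0"
    by (auto simp: p_def q_def fun_eq_iff sup_real_def inf_real_def)
  then show ?thesis
    using vl_valuation_diff[OF \<nu>(1) pq(1,3,2,4)] vl_valuation_diff[OF \<mu>(1) pq(1,3,2,4)]
      vl_valuations_agree_nonneg[OF P \<nu> \<mu> pq(1,2)] vl_valuations_agree_nonneg[OF P \<nu> \<mu> pq(3,4)]
    by simp
qed

section \<open>Existence\<close>

text \<open>The two families are merged over a disjoint sum of index sets, the second with negated
  coefficients, into one combination that vanishes pointwise.\<close>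

lemma sum_eq_if_convex_indicator_sum_eq:
  fixes C :: "'i \<Rightarrow> 'a::euclidean_space set" and D :: "'j \<Rightarrow> 'a set"
    and a :: "'i \<Rightarrow> real" and b :: "'j \<Rightarrow> real"
  assumes fin: "finite I" "finite J"
    and C: "\<And>i. i \<in> I \<Longrightarrow> compact (C i) \<and> convex (C i)"
    and D: "\<And>j. j \<in> J \<Longrightarrow> compact (D j) \<and> convex (D j)"
    and eq: "\<And>z. sum a {i \<in> I. z \<in> C i} = sum b {j \<in> J. z \<in> D j}"
  shows "sum a {i \<in> I. C i \<noteq> {}} = sum b {j \<in> J. D j \<noteq> {}}"
proof -
  let ?E = "case_sum C D" and ?e = "case_sum a (\<lambda>j. - b j)"
  have split: "sum ?e {k \<in> I <+> J. Q (?E k)} = sum a {i \<in> I. Q (C i)} - sum b {j \<in> J. Q (D j)}"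
    for Q
  proof -
    have "{k \<in> I <+> J. Q (?E k)} = {i \<in> I. Q (C i)} <+> {j \<in> J. Q (D j)}"
      by auto
    then show ?thesis
      using fin by (simp add: sum.Plus sum_negf)
  qed
  have "sum ?e {k \<in> I <+> J. ?E k \<noteq> {}} = 0"
  proof (rule sum_eq_0_if_convex_indicator_sum_eq_0)
    show "finite (I <+> J)"
      using fin by simp
    show "compact (?E k) \<and> convex (?E k)" if "k \<in> I <+> J" for k
      using that C D by auto
    show "sum ?e {k \<in> I <+> J. z \<in> ?E k} = 0" for z
      using split[of "\<lambda>S. z \<in> S"] eq[of z] by simp
  qed
  then show ?thesis
    using split[of "\<lambda>S. S \<noteq> {}"] by simp
qed

text \<open>
  For \<open>f\<close> linear on the simplices of \<open>K\<close>, the Euler characteristic of the full subcomplex spanned by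
  the vertices where \<open>f\<close> is positive, a deformation retract of the set where \<open>f\<close> is positive.
\<close>
definition positive_euler_char :: "'a::euclidean_space set set \<Rightarrow> ('a \<Rightarrow> real) \<Rightarrow> real"
  where "positive_euler_char K f =
    (\<Sum>T | T \<in> vertex_sets K \<and> T \<noteq> {} \<and> (\<forall>v\<in>T. 0 < f v). (- 1) ^ (card T + 1))"

text \<open>
  With these signs, the faces \<open>F\<close> of a simplex with vertex set \<open>V\<close> add up to the indicator of the
  relative interior of that simplex.
\<close>
definition superlevel_faces :: "'a::euclidean_space set set \<Rightarrow> ('a set \<times> 'a set) set"
  where "superlevel_faces K = (SIGMA V:vertex_sets K. Pow V - {{}})"

definition face_sign :: "'a set \<times> 'a set \<Rightarrow> real"
  where "face_sign = (\<lambda>(V, F). (- 1) ^ card V * (- 1) ^ card F)"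

context
  fixes K :: "'a::euclidean_space set set" and f :: "'a \<Rightarrow> real"
  assumes K: "simplicial_complex K" and f: "linearizes K f"
begin

lemma finite_superlevel_faces: "finite (superlevel_faces K)"
  using finite_vertex_sets[OF K] vertex_sets_finite by (auto simp: superlevel_faces_def)

lemma compact_convex_superlevel:
  assumes F: "F \<in> vertex_sets K"
  shows "compact (convex hull F \<inter> {z. t \<le> f z}) \<and> convex (convex hull F \<inter> {z. t \<le> f z})"
proof -
  obtain g where g: "affine_fun g" "\<And>z. z \<in> convex hull F \<Longrightarrow> f z = g z"
    using f F by (auto simp: linearizes_def vertex_sets_def)
  obtain a c where ac: "g = (\<lambda>x. a \<bullet> x + c)"
    using affine_fun_inner[OF g(1)] by blast
  have "convex hull F \<inter> {z. t \<le> f z} = convex hull F \<inter> {z. a \<bullet> z \<ge> t - c}"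
    using g(2) by (auto simp: ac)
  then show ?thesis
    using finite_imp_compact_convex_hull[OF vertex_sets_finite[OF F]]
    by (simp add: compact_Int_closed closed_halfspace_ge convex_Int convex_halfspace_ge)
qed

text \<open>A point \<open>z\<close> with carrier \<open>S\<close> lies in the hull of
  \<open>F\<close> exactly when \<open>S \<subseteq> F\<close>. The sum over \<open>F\<close>
  between \<open>S\<close> and \<open>V\<close> cancels unless \<open>V = S\<close>: each point lies
  in the relative interior of exactly one simplex.\<close>

lemma superlevel_indicator_sum:
  "sum face_sign {i \<in> superlevel_faces K. z \<in> convex hull (snd i) \<inter> {z. t \<le> f z}} =
    (if z \<in> \<Union>K \<and> t \<le> f z then 1 else 0)"
proof (cases "z \<in> \<Union>K \<and> t \<le> f z")
  case False
  have "{i \<in> superlevel_faces K. z \<in> convex hull (snd i) \<inter> {z. t \<le> f z}} = {}"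
  proof -
    have "z \<in> \<Union>K" if "V \<in> vertex_sets K" "F \<subseteq> V" "z \<in> convex hull F" for V F
      using that hull_mono[OF that(2), of convex] by (auto simp: vertex_sets_def)
    then show ?thesis
      using False by (fastforce simp: superlevel_faces_def)
  qed
  then show ?thesis
    using False by (simp only: sum.empty if_False)
next
  case True
  define S where "S = {v. bary K v z \<noteq> 0}"
  have S: "S \<in> vertex_sets K" "barycentric S (\<lambda>v. bary K v z) z"
    using bary_support[OF K] True by (auto simp: S_def)
  have ne: "S \<noteq> {}"
    using S(2) by (auto simp: barycentric_def)
  have iff: "z \<in> convex hull F \<longleftrightarrow> S \<subseteq> F" if "V \<in> vertex_sets K" "F \<subseteq> V" for V F
    unfolding S_def using convex_hull_iff_bary_support[OF K] vertex_sets_subset[OF K that] True by blast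
  have "{i \<in> superlevel_faces K. z \<in> convex hull (snd i) \<inter> {z. t \<le> f z}} =
      (SIGMA V:vertex_sets K. {F. S \<subseteq> F \<and> F \<subseteq> V})"
    using True ne iff by (auto simp: superlevel_faces_def)
  then have "sum face_sign {i \<in> superlevel_faces K. z \<in> convex hull (snd i) \<inter> {z. t \<le> f z}} =
      sum face_sign (SIGMA V:vertex_sets K. {F. S \<subseteq> F \<and> F \<subseteq> V})"
    by simp
  also have "\<dots> = (\<Sum>V\<in>vertex_sets K. \<Sum>F | S \<subseteq> F \<and> F \<subseteq> V. (- 1) ^ card V * (- 1) ^ card F)"
    unfolding face_sign_def using finite_vertex_sets[OF K] vertex_sets_finite
    by (subst sum.Sigma) (auto intro: finite_subset[of _ "Pow V" for V])
  also have "\<dots> = (\<Sum>V\<in>vertex_sets K. if V = S then 1 else 0)"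
  proof (rule sum.cong[OF refl])
    fix V assume V: "V \<in> vertex_sets K"
    show "(\<Sum>F | S \<subseteq> F \<and> F \<subseteq> V. (- 1) ^ card V * (- 1) ^ card F) = (if V = S then 1 else (0::real))"
    proof (cases "S \<subseteq> V")
      case True
      show ?thesis
        using sum_minus_one_power_Icc[OF vertex_sets_finite[OF V] True]
        by (auto simp flip: sum_distrib_left power_mult_distrib)
    next
      case False
      then have "{F. S \<subseteq> F \<and> F \<subseteq> V} = {}" "V \<noteq> S"
        by auto
      then show ?thesis
        by (simp only: sum.empty if_False)
    qed
  qed
  also have "\<dots> = 1"
    using S(1) finite_vertex_sets[OF K] by simp
  finally show ?thesis
    using True by simp
qed

text \<open>An affine function on a simplex attains its maximum at a vertex.\<close>

lemma superlevel_nonempty_iff: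
  assumes F: "F \<in> vertex_sets K"
  shows "convex hull F \<inter> {z. t \<le> f z} \<noteq> {} \<longleftrightarrow> (\<exists>v\<in>F. t \<le> f v)"
proof
  assume "\<exists>v\<in>F. t \<le> f v"
  then show "convex hull F \<inter> {z. t \<le> f z} \<noteq> {}"
    using hull_subset[of F convex] by blast
next
  assume "convex hull F \<inter> {z. t \<le> f z} \<noteq> {}"
  then obtain z where z: "z \<in> convex hull F" "t \<le> f z"
    by blast
  obtain g where g: "affine_fun g" "\<And>z. z \<in> convex hull F \<Longrightarrow> f z = g z"
    using f F by (auto simp: linearizes_def vertex_sets_def)
  have u: "barycentric F (\<lambda>v. bary K v z) z"
    using barycentric_bary[OF K F z(1)] .
  show "\<exists>v\<in>F. t \<le> f v"
  proof (rule ccontr)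
    assume "\<not> (\<exists>v\<in>F. t \<le> f v)"
    then have less: "g v < t" if "v \<in> F" for v
      using that g(2)[of v] hull_subset[of F convex] by force
    have sum1: "(\<Sum>v\<in>F. bary K v z) = 1"
      using u by (simp add: barycentric_def)
    have "g z = (\<Sum>v\<in>F. bary K v z * g v)"
      using affine_fun_barycentric[OF g(1) u] .
    also have "\<dots> < (\<Sum>v\<in>F. bary K v z * t)"
    proof -
      obtain w where w: "w \<in> F" "bary K w z \<noteq> 0"
        using sum1 by (metis sum.neutral zero_neq_one)
      show ?thesis
        using w less bary_nonneg[OF K] vertex_sets_finite[OF F]
        by (intro sum_strict_mono_ex1) (auto intro!: mult_left_mono bexI[of _ w] simp: less_le)
    qed
    also have "\<dots> = t"
      using sum1 by (simp flip: sum_distrib_right)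
    finally show False
      using z g(2) by force
  qed
qed

text \<open>For such \<open>t\<close> a cut is empty exactly when \<open>F\<close> lies in the set
  \<open>Z V\<close> of nonpositive vertices. The alternating sum over the remaining
  \<open>F\<close> is \<open>[V = {}] - [Z V = {}]\<close>, which is -1 if \<open>V\<close> is
  nonempty with only positive vertices and 0 otherwise; this -1 explains the exponent
  \<open>card V + 1\<close>.\<close>

lemma superlevel_sum:
  assumes t: "0 < t" "\<And>v. v \<in> \<Union>(vertex_sets K) \<Longrightarrow> 0 < f v \<Longrightarrow> t \<le> f v"
  shows "sum face_sign {i \<in> superlevel_faces K. convex hull (snd i) \<inter> {z. t \<le> f z} \<noteq> {}} =
    positive_euler_char K f"
proof -
  define Z where "Z V = {v \<in> V. f v \<le> 0}" for V
  have iff: "convex hull F \<inter> {z. t \<le> f z} \<noteq> {} \<longleftrightarrow> \<not> F \<subseteq> Z V" if "V \<in> vertex_sets K" "F \<subseteq> V" for V F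
  proof -
    have "t \<le> f v \<longleftrightarrow> 0 < f v" if "v \<in> F" for v
      using t(2)[of v] t(1) that \<open>V \<in> vertex_sets K\<close> \<open>F \<subseteq> V\<close> by force
    then show ?thesis
      using superlevel_nonempty_iff[OF vertex_sets_subset[OF K that], of t] that(2)
      by (auto simp: Z_def not_le)
  qed
  have "{i \<in> superlevel_faces K. convex hull (snd i) \<inter> {z. t \<le> f z} \<noteq> {}} =
      (SIGMA V:vertex_sets K. Pow V - Pow (Z V))"
  proof (rule set_eqI)
    fix i :: "'a set \<times> 'a set"
    obtain V F where i: "i = (V, F)"
      by (cases i)
    show "i \<in> {i \<in> superlevel_faces K. convex hull (snd i) \<inter> {z. t \<le> f z} \<noteq> {}} \<longleftrightarrow>
        i \<in> (SIGMA V:vertex_sets K. Pow V - Pow (Z V))"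
      using iff[of V F]
      by (cases "V \<in> vertex_sets K"; cases "F \<subseteq> V"; cases "F = {}") (simp_all add: i superlevel_faces_def)
  qed
  then have "sum face_sign {i \<in> superlevel_faces K. convex hull (snd i) \<inter> {z. t \<le> f z} \<noteq> {}} =
      sum face_sign (SIGMA V:vertex_sets K. Pow V - Pow (Z V))"
    by simp
  also have "\<dots> = (\<Sum>V\<in>vertex_sets K. \<Sum>F\<in>Pow V - Pow (Z V). (- 1) ^ card V * (- 1) ^ card F)"
    unfolding face_sign_def using finite_vertex_sets[OF K] vertex_sets_finite
    by (subst sum.Sigma) auto
  also have "\<dots> = (\<Sum>V\<in>vertex_sets K. if V \<noteq> {} \<and> (\<forall>v\<in>V. 0 < f v) then (- 1) ^ (card V + 1) else 0)"
  proof (rule sum.cong[OF refl])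
    fix V assume "V \<in> vertex_sets K"
    then have fin: "finite V" "finite (Z V)" and sub: "Z V \<subseteq> V"
      using vertex_sets_finite[of V K] by (auto simp: Z_def)
    have "(\<Sum>F\<in>Pow W. (- 1) ^ card F) = (if W = {} then 1 else (0::real))" if "finite W" for W :: "'a set"
      using sum_minus_one_power_Icc[OF that, of "{}"] by (auto simp: Pow_def)
    then have "(\<Sum>F\<in>Pow V - Pow (Z V). (- 1) ^ card F) =
        (if V = {} then 1 else 0) - (if Z V = {} then 1 else (0::real))"
      using fin sub by (simp add: sum_diff Pow_mono)
    moreover have "Z V = {} \<longleftrightarrow> (\<forall>v\<in>V. 0 < f v)"
      by (auto simp: Z_def not_le)
    ultimately show "(\<Sum>F\<in>Pow V - Pow (Z V). (- 1) ^ card V * (- 1) ^ card F) =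
        (if V \<noteq> {} \<and> (\<forall>v\<in>V. 0 < f v) then (- 1) ^ (card V + 1) else (0::real))"
      by (auto simp flip: sum_distrib_left)
  qed
  also have "\<dots> = positive_euler_char K f"
    unfolding positive_euler_char_def
    by (rule sum.inter_filter[OF finite_vertex_sets[OF K], symmetric])
  finally show ?thesis .
qed

lemma superlevel_threshold:
  obtains t0 where "0 < t0"
    "\<And>t v. 0 < t \<Longrightarrow> t \<le> t0 \<Longrightarrow> v \<in> \<Union>(vertex_sets K) \<Longrightarrow> 0 < f v \<Longrightarrow> t \<le> f v"
proof -
  \<comment> \<open>The 1 keeps the set nonempty when \<open>f\<close> is positive at no
    vertex.\<close>
  define M where "M = insert 1 (f ` {v \<in> \<Union>(vertex_sets K). 0 < f v})"
  have "finite {v \<in> \<Union>(vertex_sets K). 0 < f v}"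
    using finite_vertices[OF K] by (rule rev_finite_subset) blast
  then have M: "finite M" "M \<noteq> {}"
    by (simp_all add: M_def)
  show thesis
  proof (rule that[of "Min M"])
    show "0 < Min M"
      using M by (auto simp: M_def)
    show "t \<le> f v" if "t \<le> Min M" "v \<in> \<Union>(vertex_sets K)" "0 < f v" for t v
      using M that Min_le[OF M(1), of "f v"] by (auto simp: M_def)
  qed
qed

end

text \<open>At a level \<open>r\<close> below both thresholds the two triangulations yield
  combinations with the same value at every point, the indicator of \<open>f \<ge> r\<close> in
  \<open>P\<close>; hence the coefficients of their nonempty sets have equal sums.\<close>

lemma positive_euler_char_unique:
  assumes K: "triangulates K P" "linearizes K f" and L: "triangulates L P" "linearizes L f"
  shows "positive_euler_char K f = positive_euler_char L f"
proof -
  have sc: "simplicial_complex K" "simplicial_complex L" and U: "\<Union>K = P" "\<Union>L = P"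
    using K L by (auto simp: triangulates_def)
  obtain s t where s: "0 < s"
      "\<And>r v. 0 < r \<Longrightarrow> r \<le> s \<Longrightarrow> v \<in> \<Union>(vertex_sets K) \<Longrightarrow> 0 < f v \<Longrightarrow> r \<le> f v"
    and t: "0 < t"
      "\<And>r v. 0 < r \<Longrightarrow> r \<le> t \<Longrightarrow> v \<in> \<Union>(vertex_sets L) \<Longrightarrow> 0 < f v \<Longrightarrow> r \<le> f v"
    using superlevel_threshold[OF sc(1) K(2)] superlevel_threshold[OF sc(2) L(2)] by metis
  define r where "r = min s t"
  have r: "0 < r" "r \<le> s" "r \<le> t"
    using s t by (simp_all add: r_def)
  have snd_in: "snd i \<in> vertex_sets M" if "simplicial_complex M" "i \<in> superlevel_faces M"
    for i :: "'a set \<times> 'a set" and M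
    using that vertex_sets_subset[OF that(1)] by (auto simp: superlevel_faces_def)
  have "sum face_sign {i \<in> superlevel_faces K. convex hull (snd i) \<inter> {z. r \<le> f z} \<noteq> {}} =
      sum face_sign {i \<in> superlevel_faces L. convex hull (snd i) \<inter> {z. r \<le> f z} \<noteq> {}}"
    by (rule sum_eq_if_convex_indicator_sum_eq)
      (simp_all only: superlevel_indicator_sum[OF sc(1) K(2)] superlevel_indicator_sum[OF sc(2) L(2)]
        finite_superlevel_faces[OF sc(1) K(2)] finite_superlevel_faces[OF sc(2) L(2)] U
        compact_convex_superlevel[OF sc(1) K(2) snd_in[OF sc(1)]]
        compact_convex_superlevel[OF sc(2) L(2) snd_in[OF sc(2)]])
  then show ?thesis
    using superlevel_sum[OF sc(1) K(2) r(1) s(2)[OF r(1,2)]]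
      superlevel_sum[OF sc(2) L(2) r(1) t(2)[OF r(1,3)]] by simp
qed

section \<open>The valuation axioms\<close>

lemma linearizes_uminus:
  assumes "linearizes K f"
  shows "linearizes K (- f)"
  unfolding linearizes_def
proof
  fix S assume S: "S \<in> K"
  obtain u where "affine_fun u" "\<forall>x\<in>S. f x = u x"
    using assms S unfolding linearizes_def by meson
  then show "\<exists>w. affine_fun w \<and> (\<forall>x\<in>S. (- f) x = w x)"
    using affine_fun_scale[of u "- 1"] by (intro exI[of _ "\<lambda>x. - 1 * u x"]) simp
qed

lemma positive_euler_char_cong:
  assumes "\<And>v. v \<in> \<Union>(vertex_sets K) \<Longrightarrow> 0 < f v \<longleftrightarrow> 0 < g v"
  shows "positive_euler_char K f = positive_euler_char K g"
proof -
  have "{T \<in> vertex_sets K. T \<noteq> {} \<and> (\<forall>v\<in>T. 0 < f v)} = {T \<in> vertex_sets K. T \<noteq> {} \<and> (\<forall>v\<in>T. 0 < g v)}"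
    using assms by blast
  then show ?thesis
    by (simp add: positive_euler_char_def)
qed

lemma positive_euler_char_nonpos:
  assumes "\<And>v. v \<in> \<Union>(vertex_sets K) \<Longrightarrow> f v \<le> 0"
  shows "positive_euler_char K f = 0"
proof -
  have "{T \<in> vertex_sets K. T \<noteq> {} \<and> (\<forall>v\<in>T. 0 < f v)} = {}"
    using assms by (force simp: not_less[symmetric])
  then show ?thesis
    unfolding positive_euler_char_def by (simp only: sum.empty)
qed

text \<open>As the supremum is affine on the simplex too, \<open>f\<close> and \<open>g\<close> are
  comparable there: the supremum minus the function attaining it at a relative interior point is
  affine, nonnegative and zero at that point, hence zero throughout.\<close>

lemma positive_sup_iff:
  assumes T: "T \<in> vertex_sets K" "T \<noteq> {}"
    and lin: "linearizes K f" "linearizes K g" "linearizes K (sup f g)"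
  shows "(\<forall>v\<in>T. 0 < sup (f v) (g v)) \<longleftrightarrow> (\<forall>v\<in>T. 0 < f v) \<or> (\<forall>v\<in>T. 0 < g v)"
proof -
  have H: "convex hull T \<in> K"
    using T by (simp add: vertex_sets_def)
  obtain u v w where uvw: "affine_fun u" "affine_fun v" "affine_fun w"
      "\<forall>x\<in>convex hull T. f x = u x" "\<forall>x\<in>convex hull T. g x = v x"
      "\<forall>x\<in>convex hull T. sup f g x = w x"
    using lin H unfolding linearizes_def by meson
  have w: "w x = max (u x) (v x)" if "x \<in> convex hull T" for x
    using uvw(4-6) that by (auto simp: sup_real_def max_def)
  have "rel_interior (convex hull T) \<noteq> {}"
    using T(2) rel_interior_eq_empty[of "convex hull T"] by simp
  then obtain z where z: "z \<in> rel_interior (convex hull T)"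
    by blast
  have sub: "T \<subseteq> convex hull T"
    by (rule hull_subset)
  have zT: "z \<in> convex hull T"
    using z rel_interior_subset by blast
  consider "w z - u z = 0" | "w z - v z = 0"
    using w[OF zT] by linarith
  then have "(\<forall>x\<in>T. w x = u x) \<or> (\<forall>x\<in>T. w x = v x)"
  proof cases
    case 1
    have "w x - u x = 0" if "x \<in> convex hull T" for x
      using affine_fun_nonneg_eq_0[OF affine_fun_diff[OF uvw(3,1)] convex_convex_hull _ z 1 that] w
      by simp
    then show ?thesis
      using sub by auto
  next
    case 2
    have "w x - v x = 0" if "x \<in> convex hull T" for x
      using affine_fun_nonneg_eq_0[OF affine_fun_diff[OF uvw(3,2)] convex_convex_hull _ z 2 that] w
      by simp
    then show ?thesis
      using sub by auto
  qed
  then have "(\<forall>x\<in>T. g x \<le> f x) \<or> (\<forall>x\<in>T. f x \<le> g x)"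
  proof
    assume "\<forall>x\<in>T. w x = u x"
    then have "g x \<le> f x" if "x \<in> T" for x
      using w[of x] uvw(4,5) sub that by force
    then show ?thesis
      by blast
  next
    assume "\<forall>x\<in>T. w x = v x"
    then have "f x \<le> g x" if "x \<in> T" for x
      using w[of x] uvw(4,5) sub that by force
    then show ?thesis
      by blast
  qed
  then have "(\<forall>x\<in>T. 0 < g x \<longrightarrow> 0 < f x) \<or> (\<forall>x\<in>T. 0 < f x \<longrightarrow> 0 < g x)"
    using less_le_trans by metis
  then show ?thesis
    unfolding sup_real_def less_max_iff_disj by blast
qed

text \<open>The simplices positive for the supremum form the union, those positive for the infimum
  the intersection, of the two families of positive simplices.\<close>

lemma positive_euler_char_sup_inf:
  assumes K: "simplicial_complex K"
    and lin: "linearizes K f" "linearizes K g" "linearizes K (sup f g)"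
  shows "positive_euler_char K f + positive_euler_char K g =
    positive_euler_char K (sup f g) + positive_euler_char K (inf f g)"
proof -
  define A where "A h = {T \<in> vertex_sets K. T \<noteq> {} \<and> (\<forall>v\<in>T. 0 < h v)}" for h :: "'a \<Rightarrow> real"
  have fin: "finite (A h)" for h
    using finite_vertex_sets[OF K] by (simp add: A_def)
  have "A (sup f g) = A f \<union> A g"
    using positive_sup_iff[OF _ _ lin] by (auto simp: A_def)
  moreover have "A (inf f g) = A f \<inter> A g"
    by (auto simp: A_def inf_real_def)
  moreover have "positive_euler_char K h = (\<Sum>T\<in>A h. (- 1) ^ (card T + 1))" for h
    unfolding positive_euler_char_def A_def ..
  ultimately show ?thesis
    by (simp only: sum.union_inter[OF fin fin])
qed

definition hat_valuation :: "'a::euclidean_space set \<Rightarrow> ('a \<Rightarrow> real) \<Rightarrow> real"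
  where "hat_valuation P f =
    (let K = SOME K. triangulates K P \<and> linearizes K f
     in positive_euler_char K f - positive_euler_char K (- f))"

lemma hat_valuation_eq:
  assumes "triangulates K P" "linearizes K f"
  shows "hat_valuation P f = positive_euler_char K f - positive_euler_char K (- f)"
proof -
  define L where "L = (SOME K. triangulates K P \<and> linearizes K f)"
  have L: "triangulates L P" "linearizes L f"
    using someI[of "\<lambda>K. triangulates K P \<and> linearizes K f" K] assms by (auto simp: L_def)
  have "positive_euler_char L f = positive_euler_char K f"
    by (rule positive_euler_char_unique[OF L assms])
  moreover have "positive_euler_char L (- f) = positive_euler_char K (- f)"
    by (rule positive_euler_char_unique[OF L(1) linearizes_uminus[OF L(2)] assms(1)
          linearizes_uminus[OF assms(2)]])
  ultimately show ?thesis
    by (simp add: hat_valuation_def flip: L_def)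
qed

lemma vl_valuation_hat_valuation:
  fixes P :: "'a::euclidean_space set"
  assumes P: "compact_polyhedron P"
  shows "vl_valuation (nabla P) (hat_valuation P)"
  unfolding vl_valuation_def
proof (intro conjI ballI impI)
  obtain K where K: "triangulates K P" "linearizes K (0 :: 'a \<Rightarrow> real)"
    using linearizes_common[OF P, of "{0}"] nabla_zero by auto
  show "hat_valuation P 0 = 0"
    unfolding hat_valuation_eq[OF K] by simp
next
  fix f g :: "'a \<Rightarrow> real"
  assume fg: "f \<in> nabla P" "g \<in> nabla P"
  obtain K where K: "triangulates K P" and lin: "\<And>h. h \<in> {f, g, sup f g, inf f g} \<Longrightarrow> linearizes K h"
    using linearizes_common[OF P, of "{f, g, sup f g, inf f g}"] fg nabla_sup[OF fg] nabla_inf[OF fg]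
    by auto
  then have sc: "simplicial_complex K"
    by (simp add: triangulates_def)
  \<comment> \<open>Negation exchanges supremum and infimum, so (V2) for the subtracted terms is
    again the supremum case, applied to \<open>- f\<close> and \<open>- g\<close>.\<close>
  have neg: "sup (- f) (- g) = - inf f g" "inf (- f) (- g) = - sup f g"
    by (auto simp: fun_eq_iff sup_real_def inf_real_def)
  have l: "linearizes K f" "linearizes K g" "linearizes K (sup f g)" "linearizes K (inf f g)"
    using lin by blast+
  have "linearizes K (sup (- f) (- g))"
    unfolding neg by (rule linearizes_uminus[OF l(4)])
  then have "positive_euler_char K (- f) + positive_euler_char K (- g) =
      positive_euler_char K (- inf f g) + positive_euler_char K (- sup f g)"
    using positive_euler_char_sup_inf[OF sc linearizes_uminus[OF l(1)] linearizes_uminus[OF l(2)]]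
    unfolding neg by blast
  then show "hat_valuation P f + hat_valuation P g = hat_valuation P (sup f g) + hat_valuation P (inf f g)"
    unfolding hat_valuation_eq[OF K l(1)] hat_valuation_eq[OF K l(2)] hat_valuation_eq[OF K l(3)]
      hat_valuation_eq[OF K l(4)]
    using positive_euler_char_sup_inf[OF sc l(1-3)] by linarith
next
  fix f g :: "'a \<Rightarrow> real"
  assume fg: "f \<in> nabla P" "g \<in> nabla P" and pos: "0 \<le> f \<and> 0 \<le> g"
  obtain K where K: "triangulates K P" and lin: "\<And>h. h \<in> {f + g, sup f g} \<Longrightarrow> linearizes K h"
    using linearizes_common[OF P, of "{f + g, sup f g}"] nabla_sup[OF fg] nabla_add[OF fg] by auto
  have nonneg: "0 \<le> f v" "0 \<le> g v" for v
    using pos by (simp_all add: le_fun_def)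
  have "positive_euler_char K (f + g) = positive_euler_char K (sup f g)"
  proof (rule positive_euler_char_cong)
    show "0 < (f + g) v \<longleftrightarrow> 0 < sup f g v" for v
      using nonneg[of v] by (auto simp: sup_real_def)
  qed
  moreover have "positive_euler_char K (- (f + g)) = positive_euler_char K (- sup f g)"
  proof (rule positive_euler_char_cong)
    show "0 < (- (f + g)) v \<longleftrightarrow> 0 < (- sup f g) v" for v
      using nonneg[of v] by (auto simp: sup_real_def)
  qed
  ultimately show "hat_valuation P (f + g) = hat_valuation P (sup f g)"
    using hat_valuation_eq[OF K lin] by simp
next
  fix f g :: "'a \<Rightarrow> real"
  assume fg: "f \<in> nabla P" "g \<in> nabla P" and pos: "0 \<le> f \<and> 0 \<le> g \<and> inf f g = 0"
  obtain K where K: "triangulates K P" and lin: "\<And>h. h \<in> {f, g, f - g} \<Longrightarrow> linearizes K h"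
    using linearizes_common[OF P, of "{f, g, f - g}"] fg nabla_diff[OF fg] by auto
  have v: "0 \<le> f v" "0 \<le> g v" "min (f v) (g v) = 0" for v
    using pos by (simp_all add: le_fun_def fun_eq_iff inf_real_def)
  \<comment> \<open>At each point one of \<open>f\<close>, \<open>g\<close> is 0, so
    \<open>f - g\<close> is positive exactly where \<open>f\<close> is, and its negative exactly
    where \<open>g\<close> is.\<close>
  have "positive_euler_char K (f - g) = positive_euler_char K f"
  proof (rule positive_euler_char_cong)
    show "0 < (f - g) w \<longleftrightarrow> 0 < f w" for w
      using v[of w] by (simp add: min_def split: if_splits)
  qed
  moreover have "positive_euler_char K (- (f - g)) = positive_euler_char K g"
  proof (rule positive_euler_char_cong)
    show "0 < (- (f - g)) w \<longleftrightarrow> 0 < g w" for w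
      using v[of w] by (simp add: min_def split: if_splits)
  qed
  moreover have "positive_euler_char K (- f) = 0" "positive_euler_char K (- g) = 0"
    using v by (auto intro: positive_euler_char_nonpos)
  ultimately show "hat_valuation P (f - g) = hat_valuation P f - hat_valuation P g"
    using hat_valuation_eq[OF K lin] by simp
qed

text \<open>Closure of \<open>nabla P\<close> under the operations keeps every argument in the
  axioms inside it. This allows the valuation to be restricted to an extensional function.\<close>

lemma vl_valuation_nabla_cong:
  assumes "vl_valuation (nabla P) \<nu>" and eq: "\<And>f. f \<in> nabla P \<Longrightarrow> \<mu> f = \<nu> f"
  shows "vl_valuation (nabla P) \<mu>"
  unfolding vl_valuation_def
proof (intro conjI ballI impI)
  show "\<mu> 0 = 0"
    using vl_valuation_0[OF assms(1)] eq[OF nabla_zero] by (rule trans[rotated])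
next
  fix f g assume f: "f \<in> nabla P" and g: "g \<in> nabla P"
  note [simp] = eq[OF f] eq[OF g] eq[OF nabla_sup[OF f g]] eq[OF nabla_inf[OF f g]]
    eq[OF nabla_add[OF f g]] eq[OF nabla_diff[OF f g]]
  show "\<mu> f + \<mu> g = \<mu> (sup f g) + \<mu> (inf f g)"
    using vl_valuation_sup[OF assms(1) f g] by (simp del: sup_apply inf_apply)
  show "\<mu> (f + g) = \<mu> (sup f g)" if "0 \<le> f \<and> 0 \<le> g"
    using vl_valuation_add[OF assms(1) f g] that by simp
  show "\<mu> (f - g) = \<mu> f - \<mu> g" if "0 \<le> f \<and> 0 \<le> g \<and> inf f g = 0"
    using vl_valuation_diff[OF assms(1) f g] that by simp
qed

section \<open>Values at hats and at the unit\<close>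

text \<open>The only nonempty simplex of \<open>K\<close> on whose vertices \<open>h\<close> is
  positive is the vertex \<open>x\<close> itself.\<close>

lemma hat_valuation_hat:
  assumes "vl_schauder_hat P h"
  shows "hat_valuation P h = 1"
proof -
  obtain K x where K: "triangulates K P" "linearizes K h" and x: "x \<in> \<Union>(vertex_sets K)" "h x = 1"
    and other: "\<And>y. y \<in> \<Union>(vertex_sets K) \<Longrightarrow> y \<noteq> x \<Longrightarrow> h y = 0"
    using assms unfolding vl_schauder_hat_def vertex_of_iff by auto
  have "{x} \<in> vertex_sets K"
    using x(1) K(1) vertex_sets_subset[of K _ "{x}"] by (auto simp: triangulates_def)
  then have "{{x}} \<subseteq> {T \<in> vertex_sets K. T \<noteq> {} \<and> (\<forall>v\<in>T. 0 < h v)}"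
    using x(2) by simp
  moreover have "{T \<in> vertex_sets K. T \<noteq> {} \<and> (\<forall>v\<in>T. 0 < h v)} \<subseteq> {{x}}"
    using other by (force simp: less_irrefl)
  ultimately have "{T \<in> vertex_sets K. T \<noteq> {} \<and> (\<forall>v\<in>T. 0 < h v)} = {{x}}"
    by (rule subset_antisym[rotated])
  then have "positive_euler_char K h = 1"
    by (simp add: positive_euler_char_def)
  moreover have "positive_euler_char K (- h) = 0"
  proof (rule positive_euler_char_nonpos)
    show "(- h) v \<le> 0" if "v \<in> \<Union>(vertex_sets K)" for v
      using other[OF that] x(2) by (cases "v = x") auto
  qed
  ultimately show ?thesis
    using hat_valuation_eq[OF K] by simp
qed

lemma complex_euler_char_eq:
  fixes K :: "'a::euclidean_space set set"
  assumes K: "simplicial_complex K"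
  shows "real_of_int (complex_euler_char K) =
    (\<Sum>T | T \<in> vertex_sets K \<and> T \<noteq> {}. (- 1) ^ (card T + 1))"
proof -
  define A where "A = {T \<in> vertex_sets K. T \<noteq> {}}"
  have fin: "finite A"
    using finite_vertex_sets[OF K] by (simp add: A_def)
  have card: "card {S \<in> K. int m simplex S} = card {T \<in> A. card T - 1 = m}" for m
  proof -
    have "{S \<in> K. int m simplex S} = ((hull) convex) ` {T \<in> A. card T - 1 = m}"
    proof (intro set_eqI iffI)
      fix S assume "S \<in> {S \<in> K. int m simplex S}"
      then obtain T where "S \<in> K" "\<not> affine_dependent T" "int (card T) = int m + 1" "S = convex hull T"
        by (auto simp: simplex_def)
      moreover from this have "T \<noteq> {}" "card T - 1 = m"
        by auto
      ultimately show "S \<in> ((hull) convex) ` {T \<in> A. card T - 1 = m}"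
        by (auto simp: A_def vertex_sets_def)
    next
      fix S assume "S \<in> ((hull) convex) ` {T \<in> A. card T - 1 = m}"
      then obtain T where T: "S = convex hull T" "T \<in> vertex_sets K" "T \<noteq> {}" "card T - 1 = m"
        by (auto simp: A_def)
      then have "int (card T) = int m + 1"
        using vertex_sets_finite[OF T(2)] card_gt_0_iff[of T] by linarith
      then show "S \<in> {S \<in> K. int m simplex S}"
        using T by (auto simp: vertex_sets_def simplex_def)
    qed
    moreover have "inj_on ((hull) convex) {T \<in> A. card T - 1 = m}"
      by (rule inj_on_subset[OF inj_on_convex_hull_vertex_sets[of K]]) (auto simp: A_def)
    ultimately show ?thesis
      by (simp add: card_image)
  qed
  \<comment> \<open>An affinely independent set has at most \<open>DIM('a) + 1\<close> points, so
    the sum over dimensions misses no simplex. On \<open>A\<close> the truncated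
    \<open>card T - 1\<close> is the true dimension, as \<open>T\<close> is nonempty.\<close>
  have le: "card T - 1 \<in> {0..DIM('a)}" if "T \<in> A" for T
    using that aff_dim_le_DIM[of T] aff_dim_affine_independent[of T]
    by (auto simp: A_def vertex_sets_def)
  have "(\<Sum>T\<in>A. (- 1) ^ (card T + 1) :: real) = (\<Sum>T\<in>A. (- 1) ^ (card T - 1))"
  proof (rule sum.cong[OF refl])
    fix T assume "T \<in> A"
    then obtain k where "card T = Suc k"
      using vertex_sets_finite[of T K] by (cases "card T") (auto simp: A_def)
    then show "(- 1 :: real) ^ (card T + 1) = (- 1) ^ (card T - 1)"
      by simp
  qed
  also have "\<dots> = (\<Sum>m\<in>{0..DIM('a)}. \<Sum>T\<in>{T \<in> A. card T - 1 = m}. (- 1) ^ (card T - 1))"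
    using fin le by (intro sum.group[symmetric]) auto
  also have "\<dots> = (\<Sum>m\<in>{0..DIM('a)}. (- 1) ^ m * real (card {T \<in> A. card T - 1 = m}))"
    by (intro sum.cong refl) simp
  also have "\<dots> = real_of_int (complex_euler_char K)"
    by (simp add: complex_euler_char_def card)
  finally show ?thesis
    by (simp add: A_def)
qed

lemma hat_valuation_indicator:
  assumes K: "triangulates K P"
  shows "hat_valuation P (indicator P) = real_of_int (complex_euler_char K)"
proof -
  have sc: "simplicial_complex K" and U: "\<Union>K = P"
    using K by (auto simp: triangulates_def)
  have "\<forall>x\<in>S. indicator P x = (1 :: real)" if "S \<in> K" for S
    using U that by (auto simp: indicator_def)
  then have lin: "linearizes K (indicator P)"
    unfolding linearizes_def using affine_fun_const[of 1] by blast
  have ind: "indicator P v = (1 :: real)" if "T \<in> vertex_sets K" "v \<in> T" for T v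
    using that hull_subset[of T convex] U by (force simp: vertex_sets_def indicator_def)
  then have "{T \<in> vertex_sets K. T \<noteq> {} \<and> (\<forall>v\<in>T. 0 < (indicator P v :: real))} =
      {T \<in> vertex_sets K. T \<noteq> {}}"
    by auto
  then have "positive_euler_char K (indicator P) = real_of_int (complex_euler_char K)"
    unfolding positive_euler_char_def complex_euler_char_eq[OF sc] by simp
  moreover have "positive_euler_char K (- indicator P) = 0"
    by (rule positive_euler_char_nonpos) simp
  ultimately show ?thesis
    using hat_valuation_eq[OF K lin] by simp
qed

theorem mainTheorem1:
  fixes P :: "(real ^ 'n) set"
  assumes "compact_polyhedron P"
  shows "(\<exists>!\<alpha>. \<alpha> \<in> extensional (nabla P) \<and> vl_valuation (nabla P) \<alpha> \<and>
            (\<forall>h. vl_schauder_hat P h \<longrightarrow> \<alpha> h = 1)) \<and>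
         (\<forall>\<alpha>. vl_valuation (nabla P) \<alpha> \<and> (\<forall>h. vl_schauder_hat P h \<longrightarrow> \<alpha> h = 1) \<longrightarrow>
            \<alpha> (indicator P) = of_int (euler_char P)) \<and>
         (\<forall>K. triangulates K P \<longrightarrow> complex_euler_char K = euler_char P)"
proof -
  \<comment> \<open>Fixing the values outside \<open>nabla P\<close> turns uniqueness on
    \<open>nabla P\<close> into equality of functions.\<close>
  let ?\<alpha> = "restrict (hat_valuation P) (nabla P)"
  have val: "vl_valuation (nabla P) ?\<alpha>"
    by (rule vl_valuation_nabla_cong[OF vl_valuation_hat_valuation[OF assms]]) (rule restrict_apply')
  have hat: "?\<alpha> h = 1" if "vl_schauder_hat P h" for h
  proof -
    have "h \<in> nabla P"
      using that unfolding vl_schauder_hat_def by (rule conjunct1)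
    then show ?thesis
      using hat_valuation_hat[OF that] by (simp only: restrict_apply')
  qed
  have agree: "\<alpha> f = hat_valuation P f"
    if \<alpha>: "vl_valuation (nabla P) \<alpha>" "\<forall>h. vl_schauder_hat P h \<longrightarrow> \<alpha> h = 1" and f: "f \<in> nabla P" for \<alpha> f
  proof (rule vl_valuations_agree[OF assms \<alpha>(1) _ vl_valuation_hat_valuation[OF assms] _ f])
    show "\<alpha> h = 1" if "vl_schauder_hat P h" for h
      using \<alpha>(2) that by blast
  qed (rule hat_valuation_hat)
  have euler: "hat_valuation P (indicator P) = of_int (complex_euler_char K)"
    if "triangulates K P" for K
    using hat_valuation_indicator[OF that] .
  \<comment> \<open>The fact \<open>euler\<close> holds for every triangulation and its left side
    does not mention \<open>K\<close>; applied to the chosen one, it ties \<open>euler_char\<close>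
    to all the others.\<close>
  have "triangulates (SOME K. triangulates K P) P"
    using assms unfolding compact_polyhedron_def by (rule someI_ex)
  then have euler_P: "hat_valuation P (indicator P) = of_int (euler_char P)"
    unfolding euler_char_def by (rule euler)
  show ?thesis
  proof (intro conjI allI impI ex1I[of _ ?\<alpha>])
    show "?\<alpha> \<in> extensional (nabla P)"
      by simp
    show "vl_valuation (nabla P) ?\<alpha>"
      by (rule val)
    show "?\<alpha> h = 1" if "vl_schauder_hat P h" for h
      using that by (rule hat)
  next
    fix \<alpha>
    assume \<alpha>: "\<alpha> \<in> extensional (nabla P) \<and> vl_valuation (nabla P) \<alpha> \<and>
        (\<forall>h. vl_schauder_hat P h \<longrightarrow> \<alpha> h = 1)"
    show "\<alpha> = ?\<alpha>"
    proof (rule extensionalityI[of _ "nabla P"])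
      show "\<alpha> f = ?\<alpha> f" if "f \<in> nabla P" for f
        using agree[of \<alpha> f] \<alpha> that by simp
    qed (use \<alpha> in simp_all)
  next
    fix \<alpha>
    assume "vl_valuation (nabla P) \<alpha> \<and> (\<forall>h. vl_schauder_hat P h \<longrightarrow> \<alpha> h = 1)"
    then show "\<alpha> (indicator P) = of_int (euler_char P)"
      using agree[of \<alpha> "indicator P"] nabla_unit[of P] euler_P by simp
  next
    fix K assume "triangulates K P"
    then show "complex_euler_char K = euler_char P"
      using euler[of K] euler_P by simp
  qed
qed

end
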